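(* Termination of loops of the form ${\tt P_1}$ over $\mathbb{Z}$ is undecidable: there is no algorithm which, given $N,m\ge1$, a matrix $A\in\mathbb{Q}^{N\times N}$ and polynomials $P_1,\ldots,P_m\in\mathbb{Q}[x_1,\ldots,x_N]$, decides whether the loop \[ {\bf while}\ \big(P_1(X)>0\wedge\cdots\wedge P_m(X)>0\big)\ \{X:=AX\} \] terminates for every input $X\in\mathbb{Z}^N$.
   Context: The loop terminates on input $X$ if there exists $n\ge0$ such that $P_i(A^nX)\le 0$ for some $i$. The loop is called terminating over $\mathbb{Z}$ if it terminates on every input $X\in\mathbb{Z}^N$. *)

theory Defs
  imports
    "Jordan_Normal_Form.Matrix"
    "HOL-Library.Poly_Mapping"
    "HOL-Library.Nat_Bijection"
begin

datatype recf =
    Zero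
  | Succ
  | Proj nat
  | Comp recf "recf list"
  | Prim recf recf
  | Mu recf

text \<open>
  These are Kleene's partial recursive functions, our model of algorithms:
  \<open>computes f xs y\<close> says that program \<open>f\<close> halts on the argument tuple \<open>xs\<close> with output \<open>y\<close>.
  Composition is strict (all inner programs must halt).  The recursion argument of
  \<open>Prim\<close> and the search argument of \<open>Mu\<close> come first; the step program of \<open>Prim\<close> receives
  the predecessor, the previous value and the parameters.  \<open>Mu f\<close> is unbounded search for the
  least zero and requires \<open>f\<close> to halt on all smaller values.
\<close>

inductive computes :: "recf \<Rightarrow> nat list \<Rightarrow> nat \<Rightarrow> bool" where
  computes_Zero: "computes Zero xs 0"
| computes_Succ: "computes Succ [x] (Suc x)"
| computes_Proj: "i < length xs \<Longrightarrow> computes (Proj i) xs (xs ! i)"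
| computes_Comp: "list_all2 (\<lambda>g y. computes g xs y) gs ys \<Longrightarrow> computes f ys z \<Longrightarrow>
    computes (Comp f gs) xs z"
| computes_Prim_0: "computes f xs y \<Longrightarrow> computes (Prim f g) (0 # xs) y"
| computes_Prim_Suc: "computes (Prim f g) (n # xs) r \<Longrightarrow> computes g (n # r # xs) y \<Longrightarrow>
    computes (Prim f g) (Suc n # xs) y"
| computes_Mu: "computes f (n # xs) 0 \<Longrightarrow>
    (\<And>k. k < n \<Longrightarrow> \<exists>v>0. computes f (k # xs) v) \<Longrightarrow>
    computes (Mu f) xs n"

lemma computes_deterministic:
  "computes f xs y \<Longrightarrow> computes f xs z \<Longrightarrow> y = z"
proof (induction arbitrary: z rule: computes.induct)
  case (computes_Comp xs gs ys f w)
  from computes_Comp.prems obtain ys' where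
    ys': "list_all2 (\<lambda>g y. computes g xs y) gs ys'" "computes f ys' z"
    by (cases rule: computes.cases) auto
  have "ys = ys'"
    using computes_Comp.IH(1) ys'(1) by (auto simp: list_all2_conv_all_nth list_eq_iff_nth_eq)
  then show ?case using computes_Comp.IH(2) ys'(2) by blast
next
  case (computes_Prim_0 f xs y g)
  from computes_Prim_0.prems have "computes f xs z"
    by (cases rule: computes.cases) auto
  then show ?case using computes_Prim_0.IH by blast
next
  case (computes_Prim_Suc f g n xs r y)
  from computes_Prim_Suc.prems obtain r' where
    "computes (Prim f g) (n # xs) r'" "computes g (n # r' # xs) z"
    by (cases rule: computes.cases) auto
  then show ?case using computes_Prim_Suc.IH by blast
next
  case (computes_Mu f n xs)
  from computes_Mu.prems have
    z: "computes f (z # xs) 0" "\<And>k. k < z \<Longrightarrow> \<exists>v>0. computes f (k # xs) v"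
    by (auto elim: computes.cases)
  have "\<not> n < z"
    using z(2)[of n] computes_Mu.IH(1) by fastforce
  moreover have "\<not> z < n"
    using z(1) computes_Mu.IH(2)[of z] by fastforce
  ultimately show ?case by simp
qed (auto elim: computes.cases)

text \<open>
  A monomial maps each variable index to its exponent, and a polynomial maps each monomial to
  its coefficient, both with finite support.  Variables are numbered from \<open>0\<close> to \<open>N - 1\<close>, like
  the coordinates of vectors.
\<close>

type_synonym monomial = "nat \<Rightarrow>\<^sub>0 nat"
type_synonym rat_mpoly = "monomial \<Rightarrow>\<^sub>0 rat"

definition polys_in :: "nat \<Rightarrow> rat_mpoly set" where
  "polys_in N = {P. \<forall>t \<in> Poly_Mapping.keys P. Poly_Mapping.keys t \<subseteq> {..<N}}"

definition mpoly_eval :: "rat_mpoly \<Rightarrow> rat vec \<Rightarrow> rat" where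
  "mpoly_eval P x = (\<Sum>t \<in> Poly_Mapping.keys P. Poly_Mapping.lookup P t *
    (\<Prod>i \<in> Poly_Mapping.keys t. (x $ i) ^ Poly_Mapping.lookup t i))"

definition terminates_on :: "rat mat \<Rightarrow> rat_mpoly list \<Rightarrow> rat vec \<Rightarrow> bool" where
  "terminates_on A Ps x \<longleftrightarrow> (\<exists>n. \<exists>i < length Ps. mpoly_eval (Ps ! i) ((A ^\<^sub>m n) *\<^sub>v x) \<le> 0)"

definition terminating_over_Z :: "nat \<Rightarrow> rat mat \<Rightarrow> rat_mpoly list \<Rightarrow> bool" where
  "terminating_over_Z N A Ps \<longleftrightarrow>
    (\<forall>X :: int vec. X \<in> carrier_vec N \<longrightarrow> terminates_on A Ps (map_vec rat_of_int X))"

text \<open>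
  Rationals are coded by numerator and denominator in lowest terms, matrices by the list of
  their rows, and a polynomial in \<open>N\<close> variables by the list of its terms with nonzero
  coefficient, each given by its exponent vector and its coefficient;
  \<^const>\<open>Poly_Mapping.items\<close> lists the terms in lexicographic order of the monomials.
\<close>

definition rat_code :: "rat \<Rightarrow> nat" where
  "rat_code r = (case quotient_of r of (p, q) \<Rightarrow> prod_encode (int_encode p, nat q))"

definition mat_code :: "rat mat \<Rightarrow> nat" where
  "mat_code A = list_encode (map (\<lambda>row. list_encode (map rat_code row)) (mat_to_list A))"

definition monomial_code :: "nat \<Rightarrow> monomial \<Rightarrow> nat" where
  "monomial_code N t = list_encode (map (Poly_Mapping.lookup t) [0..<N])"

definition poly_code :: "nat \<Rightarrow> rat_mpoly \<Rightarrow> nat" where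
  "poly_code N P = list_encode
     (map (\<lambda>(t, c). prod_encode (monomial_code N t, rat_code c)) (Poly_Mapping.items P))"

definition polys_code :: "nat \<Rightarrow> rat_mpoly list \<Rightarrow> nat" where
  "polys_code N Ps = list_encode (map (poly_code N) Ps)"

end

theory Submission
  imports Defs
begin

text \<open>
  A predicate is exponential Diophantine if it is an existential projection of a system of
  equations in sums, products and powers of two.  Every recursively enumerable predicate is of
  this kind (Davis, Putnam, Robinson).  Here this is shown by induction on the program: a number
  written in a large base \<open>2 ^ (q + 2)\<close> stores a whole family of values, one per digit, and the
  statement ``\<open>f\<close> computes the digits of \<open>Y\<close> from the digits of \<open>Xs\<close>, at every digit position
  marked by \<open>M\<close>'' is expressed by arithmetic on \<open>Xs\<close>, \<open>M\<close>, \<open>Y\<close> and further numbers.  A recursion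
  or a search unrolls into a run of equally spaced digits, and its consecutive steps are related
  by multiplying with a power of the base.

  A linear loop with polynomial guards solves such systems.  The unknowns are constant
  coordinates, and the iteration replaces the Pell equations of the MRDP theorem: a counter that
  decreases by one and an integer that is halved in every step can satisfy suitable polynomial
  inequalities forever only if they started as \<open>a\<close> and \<open>2 ^ a\<close>.  The loop fails to terminate on some
  integer input iff the system has a solution.

  The parameter \<open>e\<close> of a predicate is a single matrix entry.  A decider \<open>f\<close> of termination gives
  the predicate ``\<open>f\<close> says that the loop described by \<open>e\<close>, run with parameter \<open>e\<close>, terminates'';
  the loop of this predicate, run with its own description as parameter, contradicts \<open>f\<close>.
\<close>

subsection \<open>Exponential Diophantine predicates\<close>


text \<open>The obstacle on the way from programs to equations is the universal quantifier inside a
  recursion or a search: unboundedly many steps must all be correct, but a system has a fixed number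
  of unknowns. With digits, one instance of the inner program covers all of its calls, and what
  remains of the quantifier is a bitwise comparison of two numbers. By Lucas's theorem this is the
  parity of a binomial coefficient, which division extracts from powers of two. The parameter stays
  out of the polynomials, so that a predicate fixes its guards once and for all, and the code of the
  matrix is an explicit function of \<open>e\<close> with two constants. The self-referential value
  of \<open>e\<close> can then be formed from the finished loop, without a fixed-point
  theorem.\<close>

datatype 'v atom =
    Is_const 'v nat
  | Is_sum 'v 'v 'v
  | Is_prod 'v 'v 'v
  | Is_exp 'v 'v

primrec holds :: "('v \<Rightarrow> nat) \<Rightarrow> 'v atom \<Rightarrow> bool" where
  "holds \<sigma> (Is_const u c) \<longleftrightarrow> \<sigma> u = c"
| "holds \<sigma> (Is_sum u v w) \<longleftrightarrow> \<sigma> u = \<sigma> v + \<sigma> w"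
| "holds \<sigma> (Is_prod u v w) \<longleftrightarrow> \<sigma> u = \<sigma> v * \<sigma> w"
| "holds \<sigma> (Is_exp u v) \<longleftrightarrow> \<sigma> u = 2 ^ \<sigma> v"

lemma holds_map_atom: "holds \<sigma> (map_atom g a) \<longleftrightarrow> holds (\<sigma> \<circ> g) a"
  by (cases a) auto

text \<open>
  The predicates are over infinite valuations of the free variables; \<open>Inl i\<close> refers to the free
  variable \<open>i\<close> and \<open>Inr i\<close> to an existentially quantified one.
\<close>

definition exp_dioph :: "((nat \<Rightarrow> nat) \<Rightarrow> bool) \<Rightarrow> bool" where
  "exp_dioph P \<longleftrightarrow> (\<exists>C :: (nat + nat) atom list.
    \<forall>\<rho>. P \<rho> \<longleftrightarrow> (\<exists>\<tau>. \<forall>a \<in> set C. holds (case_sum \<rho> \<tau>) a))"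

text \<open>De Bruijn style: the value is variable \<open>0\<close> and the arguments are shifted by
  one, as for the quantified variable in \<open>exp_dioph_ex\<close>.\<close>

definition exp_dioph_fun :: "((nat \<Rightarrow> nat) \<Rightarrow> nat) \<Rightarrow> bool" where
  "exp_dioph_fun t \<longleftrightarrow> exp_dioph (\<lambda>\<rho>. \<rho> 0 = t (\<lambda>i. \<rho> (Suc i)))"

definition exp_dioph_list :: "nat \<Rightarrow> ((nat \<Rightarrow> nat) \<Rightarrow> nat list) \<Rightarrow> bool" where
  "exp_dioph_list k l \<longleftrightarrow> (\<forall>\<rho>. length (l \<rho>) = k) \<and> (\<forall>i < k. exp_dioph_fun (\<lambda>\<rho>. l \<rho> ! i))"

lemma exp_diophE:
  assumes "exp_dioph P"
  obtains C :: "(nat + nat) atom list" where "\<And>\<rho>. P \<rho> \<longleftrightarrow> (\<exists>\<tau>. \<forall>a \<in> set C. holds (case_sum \<rho> \<tau>) a)"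
proof -
  from assms obtain C :: "(nat + nat) atom list" where "\<forall>\<rho>. P \<rho> \<longleftrightarrow> (\<exists>\<tau>. \<forall>a \<in> set C. holds (case_sum \<rho>
      \<tau>) a)"
    unfolding exp_dioph_def ..
  from that[OF this[rule_format]] show thesis .
qed

lemma exp_dioph_atom: "exp_dioph (\<lambda>\<rho>. holds \<rho> a)"
  unfolding exp_dioph_def
  by (rule exI[of _ "[map_atom Inl a]"]) (simp add: holds_map_atom comp_def)

lemma exp_dioph_const: "exp_dioph (\<lambda>\<rho>. b)"
proof (cases b)
  case True
  then show ?thesis unfolding exp_dioph_def by (intro exI[of _ "[]"]) simp
next
  case False
  then show ?thesis unfolding exp_dioph_def
    by (intro exI[of _ "[Is_const (Inr 0) 0, Is_const (Inr 0) 1]"]) auto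
qed

lemma exp_dioph_conj:
  assumes "exp_dioph P" "exp_dioph Q"
  shows "exp_dioph (\<lambda>\<rho>. P \<rho> \<and> Q \<rho>)"
proof -
  obtain C :: "(nat + nat) atom list" where C: "\<And>\<rho>. P \<rho> \<longleftrightarrow> (\<exists>\<tau>. \<forall>a \<in> set C. holds (case_sum \<rho> \<tau>) a)"
    by (rule exp_diophE[OF assms(1)]) blast
  obtain D :: "(nat + nat) atom list" where D: "\<And>\<rho>. Q \<rho> \<longleftrightarrow> (\<exists>\<tau>. \<forall>a \<in> set D. holds (case_sum \<rho> \<tau>) a)"
    by (rule exp_diophE[OF assms(2)]) blast
  \<comment> \<open>The unknowns of \<open>C\<close> move to even and those of \<open>D\<close> to
    odd indices, so that the two systems share only the free variables.\<close>
  define r :: "nat \<Rightarrow> nat + nat \<Rightarrow> nat + nat" where "r e = map_sum id (\<lambda>i. 2 * i + e)" for e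
  have r: "case_sum \<rho> \<tau> \<circ> r e = case_sum \<rho> (\<lambda>i. \<tau> (2 * i + e))" for \<rho> \<tau> :: "nat \<Rightarrow> nat" and e
    by (rule ext, rename_tac x, case_tac x) (simp_all add: r_def)
  have "P \<rho> \<and> Q \<rho> \<longleftrightarrow>
    (\<exists>\<tau>. \<forall>a \<in> set (map (map_atom (r 0)) C @ map (map_atom (r 1)) D). holds (case_sum \<rho> \<tau>) a)" for \<rho>
  proof
    assume "P \<rho> \<and> Q \<rho>"
    then obtain t u where t: "\<forall>a \<in> set C. holds (case_sum \<rho> t) a" and u: "\<forall>a \<in> set D. holds
        (case_sum \<rho> u) a"
      using C D by auto
    show "\<exists>\<tau>. \<forall>a \<in> set (map (map_atom (r 0)) C @ map (map_atom (r 1)) D). holds (case_sum \<rho> \<tau>) a"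
      by (rule exI[of _ "\<lambda>i. if even i then t (i div 2) else u (i div 2)"])
        (use t u in \<open>auto simp: holds_map_atom r\<close>)
  next
    assume "\<exists>\<tau>. \<forall>a \<in> set (map (map_atom (r 0)) C @ map (map_atom (r 1)) D). holds (case_sum \<rho> \<tau>) a"
    then obtain t where "\<forall>a \<in> set C. holds (case_sum \<rho> (\<lambda>i. t (2 * i + 0))) a"
      "\<forall>a \<in> set D. holds (case_sum \<rho> (\<lambda>i. t (2 * i + 1))) a"
      by (auto simp: holds_map_atom r ball_Un)
    then show "P \<rho> \<and> Q \<rho>"
      unfolding C D by blast
  qed
  then show ?thesis unfolding exp_dioph_def by blast
qed

lemma exp_dioph_subst:
  assumes "exp_dioph P"
  shows "exp_dioph (\<lambda>\<rho>. P (\<lambda>i. \<rho> (f i)))"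
proof -
  obtain C :: "(nat + nat) atom list" where C: "\<And>\<rho>. P \<rho> \<longleftrightarrow> (\<exists>\<tau>. \<forall>a \<in> set C. holds (case_sum \<rho> \<tau>) a)"
    by (rule exp_diophE[OF assms]) blast
  have r: "case_sum \<rho> \<tau> \<circ> map_sum f id = case_sum (\<lambda>i. \<rho> (f i)) \<tau>" for \<rho> \<tau> :: "nat \<Rightarrow> nat"
    by (rule ext, rename_tac x, case_tac x) simp_all
  show ?thesis unfolding exp_dioph_def
    by (rule exI[of _ "map (map_atom (map_sum f id)) C"]) (simp add: C holds_map_atom r)
qed

text \<open>The new free variable \<open>0\<close> becomes the unknown \<open>0\<close>, and the
  other unknowns move up by one. As an introduction rule this leaves shifted valuations in the goal,
  which \<open>exp_dioph_fun_subst\<close> absorbs.\<close>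

lemma exp_dioph_ex:
  assumes "exp_dioph (\<lambda>\<rho>. P (\<rho> 0) (\<lambda>i. \<rho> (Suc i)))"
  shows "exp_dioph (\<lambda>\<rho>. \<exists>v. P v \<rho>)"
proof -
  obtain C :: "(nat + nat) atom list" where C: "\<And>\<rho>. P (\<rho> 0) (\<lambda>i. \<rho> (Suc i)) \<longleftrightarrow> (\<exists>\<tau>. \<forall>a \<in> set C. holds
      (case_sum \<rho> \<tau>) a)"
    by (rule exp_diophE[OF assms]) blast
  define r :: "nat + nat \<Rightarrow> nat + nat"
    where "r = case_sum (case_nat (Inr 0) Inl) (\<lambda>i. Inr (Suc i))"
  have r: "case_sum \<rho> \<tau> \<circ> r = case_sum (case_nat (\<tau> 0) \<rho>) (\<lambda>i. \<tau> (Suc i))" for \<rho> \<tau> :: "nat \<Rightarrow> nat"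
    by (rule ext, rename_tac x, case_tac x) (simp_all add: r_def split: nat.split)
  have P: "P v \<rho> \<longleftrightarrow> (\<exists>\<tau>. \<forall>a \<in> set C. holds (case_sum (case_nat v \<rho>) \<tau>) a)" for v \<rho>
    using C[of "case_nat v \<rho>"] by simp
  have "(\<exists>v. P v \<rho>) \<longleftrightarrow> (\<exists>\<tau>. \<forall>a \<in> set (map (map_atom r) C). holds (case_sum \<rho> \<tau>) a)" for \<rho>
  proof
    assume "\<exists>v. P v \<rho>"
    then obtain v \<tau> where "\<forall>a \<in> set C. holds (case_sum (case_nat v \<rho>) \<tau>) a"
      using P by auto
    then show "\<exists>\<tau>. \<forall>a \<in> set (map (map_atom r) C). holds (case_sum \<rho> \<tau>) a"
      by (intro exI[of _ "case_nat v \<tau>"]) (simp add: holds_map_atom r)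
  qed (auto simp: P holds_map_atom r)
  then show ?thesis unfolding exp_dioph_def by blast
qed

lemma exp_dioph_fun_subst: "exp_dioph_fun t \<Longrightarrow> exp_dioph_fun (\<lambda>\<rho>. t (\<lambda>i. \<rho> (f i)))"
  using exp_dioph_subst[of "\<lambda>\<rho>. \<rho> 0 = t (\<lambda>i. \<rho> (Suc i))" "case_nat 0 (\<lambda>i. Suc (f i))"]
  by (simp add: exp_dioph_fun_def)

lemma exp_dioph_eq: "exp_dioph_fun s \<Longrightarrow> exp_dioph_fun t \<Longrightarrow> exp_dioph (\<lambda>\<rho>. s \<rho> = t \<rho>)"
proof -
  assume *: "exp_dioph_fun s" "exp_dioph_fun t"
  have "exp_dioph (\<lambda>\<rho>. \<exists>v. v = s \<rho> \<and> v = t \<rho>)"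
    by (rule exp_dioph_ex, rule exp_dioph_conj) (use * in \<open>simp_all add: exp_dioph_fun_def\<close>)
  then show ?thesis by simp
qed

lemma exp_dioph_comp2:
  assumes "exp_dioph (\<lambda>\<rho>. R (\<rho> 0) (\<rho> 1))" "exp_dioph_fun s" "exp_dioph_fun t"
  shows "exp_dioph (\<lambda>\<rho>. R (s \<rho>) (t \<rho>))"
proof -
  have "exp_dioph (\<lambda>\<rho>. \<exists>x y. y = s \<rho> \<and> x = t \<rho> \<and> R y x)"
    using assms(2)[THEN exp_dioph_fun_subst, of Suc] exp_dioph_subst[OF assms(2)[unfolded
        exp_dioph_fun_def], of "case_nat 0 (\<lambda>i. Suc (Suc i))"]
      exp_dioph_subst[OF assms(3)[unfolded exp_dioph_fun_def], of "Suc"]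
      exp_dioph_subst[OF assms(1), of "\<lambda>i. i"]
    by (intro exp_dioph_ex exp_dioph_conj) simp_all
  then show ?thesis by simp
qed

lemma exp_dioph_comp3:
  assumes "exp_dioph (\<lambda>\<rho>. R (\<rho> 0) (\<rho> 1) (\<rho> 2))" "exp_dioph_fun s" "exp_dioph_fun t" "exp_dioph_fun u"
  shows "exp_dioph (\<lambda>\<rho>. R (s \<rho>) (t \<rho>) (u \<rho>))"
proof -
  have "exp_dioph (\<lambda>\<rho>. \<exists>x y z. z = s \<rho> \<and> y = t \<rho> \<and> x = u \<rho> \<and> R z y x)"
    using exp_dioph_subst[OF assms(2)[unfolded exp_dioph_fun_def], of "case_nat 0 (\<lambda>i. Suc (Suc (Suc
        i)))"]
      exp_dioph_subst[OF assms(3)[unfolded exp_dioph_fun_def], of "case_nat 1 (\<lambda>i. Suc (Suc (Suc i)))"]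
      exp_dioph_subst[OF assms(4)[unfolded exp_dioph_fun_def], of "case_nat 2 (\<lambda>i. Suc (Suc (Suc i)))"]
      assms(1)
    by (intro exp_dioph_ex exp_dioph_conj) (simp_all add: numeral_2_eq_2)
  then show ?thesis by simp
qed

lemma exp_dioph_fun_var: "exp_dioph_fun (\<lambda>\<rho>. \<rho> i)"
proof -
  have 0: "exp_dioph (\<lambda>\<rho>. \<exists>v. \<rho> 0 = \<rho> (Suc i) + v \<and> v = 0)"
    by (rule exp_dioph_ex, rule exp_dioph_conj)
      (use exp_dioph_atom[of "Is_sum 1 (Suc (Suc i)) 0"] exp_dioph_atom[of "Is_const 0 0"] in simp_all)
  show ?thesis unfolding exp_dioph_fun_def using 0 by simp
qed

lemma exp_dioph_fun_const: "exp_dioph_fun (\<lambda>\<rho>. c)"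
  using exp_dioph_atom[of "Is_const 0 c"] by (simp add: exp_dioph_fun_def)

lemma exp_dioph_operations: "exp_dioph (\<lambda>\<rho>. \<rho> 0 = \<rho> 1 + \<rho> 2)" "exp_dioph (\<lambda>\<rho>. \<rho> 0 = \<rho> 1 * \<rho> 2)"
    "exp_dioph (\<lambda>\<rho>. \<rho> 0 = 2 ^ \<rho> 1)"
  using exp_dioph_atom[of "Is_sum 0 1 2"] exp_dioph_atom[of "Is_prod 0 1 2"] exp_dioph_atom[of
      "Is_exp 0 1"] by simp_all

lemma exp_dioph_fun_add: "exp_dioph_fun s \<Longrightarrow> exp_dioph_fun t \<Longrightarrow> exp_dioph_fun (\<lambda>\<rho>. s \<rho> + t \<rho>)"
  unfolding exp_dioph_fun_def[of "\<lambda>\<rho>. s \<rho> + t \<rho>"]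
  by (rule exp_dioph_comp3[OF exp_dioph_operations(1)]) (auto intro: exp_dioph_fun_var
      exp_dioph_fun_subst)

lemma exp_dioph_fun_mult: "exp_dioph_fun s \<Longrightarrow> exp_dioph_fun t \<Longrightarrow> exp_dioph_fun (\<lambda>\<rho>. s \<rho> * t \<rho>)"
  unfolding exp_dioph_fun_def[of "\<lambda>\<rho>. s \<rho> * t \<rho>"]
  by (rule exp_dioph_comp3[OF exp_dioph_operations(2)]) (auto intro: exp_dioph_fun_var
      exp_dioph_fun_subst)

lemma exp_dioph_fun_exp: "exp_dioph_fun s \<Longrightarrow> exp_dioph_fun (\<lambda>\<rho>. 2 ^ s \<rho>)"
  unfolding exp_dioph_fun_def[of "\<lambda>\<rho>. 2 ^ s \<rho>"]
  by (rule exp_dioph_comp2[OF exp_dioph_operations(3)]) (auto intro: exp_dioph_fun_var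
      exp_dioph_fun_subst)

lemma exp_dioph_fun_Suc: "exp_dioph_fun s \<Longrightarrow> exp_dioph_fun (\<lambda>\<rho>. Suc (s \<rho>))"
  using exp_dioph_fun_add[OF _ exp_dioph_fun_const[of 1], of s] by simp

lemmas exp_dioph_intros = exp_dioph_const exp_dioph_conj exp_dioph_ex exp_dioph_eq exp_dioph_fun_var
    exp_dioph_fun_const exp_dioph_fun_add exp_dioph_fun_mult exp_dioph_fun_exp exp_dioph_fun_Suc

lemma exp_dioph_less: "exp_dioph_fun s \<Longrightarrow> exp_dioph_fun t \<Longrightarrow> exp_dioph (\<lambda>\<rho>. s \<rho> < t \<rho>)"
proof -
  assume *: "exp_dioph_fun s" "exp_dioph_fun t"
  have "exp_dioph (\<lambda>\<rho>. \<exists>v. t \<rho> = s \<rho> + Suc v)"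
    by (intro exp_dioph_intros *[THEN exp_dioph_fun_subst])
  then show ?thesis by (simp add: less_iff_Suc_add)
qed

lemma exp_dioph_fun_diff: "exp_dioph_fun s \<Longrightarrow> exp_dioph_fun t \<Longrightarrow> exp_dioph_fun (\<lambda>\<rho>. s \<rho> - t \<rho>)"
proof -
  assume *: "exp_dioph_fun s" "exp_dioph_fun t"
  \<comment> \<open>\<open>z\<close> and \<open>v\<close> are the excesses of \<open>a\<close> over
    \<open>b\<close> and of \<open>b\<close> over \<open>a\<close>; truncation means that one of
    them is zero.\<close>
  have eq: "z = a - b \<longleftrightarrow> (\<exists>v. a + v = b + z \<and> v * z = 0)" for a b z :: nat
  proof
    assume "z = a - b"
    then show "\<exists>v. a + v = b + z \<and> v * z = 0"
      by (intro exI[of _ "b - a"]) auto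
  qed auto
  show ?thesis unfolding exp_dioph_fun_def eq
    by (intro exp_dioph_intros *[THEN exp_dioph_fun_subst])
qed

text \<open>The divisor is a successor because division with remainder does not describe
  \<open>div\<close> at zero.\<close>

lemma exp_dioph_fun_div: "exp_dioph_fun s \<Longrightarrow> exp_dioph_fun t \<Longrightarrow> exp_dioph_fun (\<lambda>\<rho>. s \<rho> div Suc (t \<rho>))"
proof -
  assume *: "exp_dioph_fun s" "exp_dioph_fun t"
  have eq: "z = a div Suc b \<longleftrightarrow> (\<exists>v. a = Suc b * z + v \<and> v < Suc b)" for a b z :: nat
    by (metis div_less div_mult_self4 add.commute add_0 mod_less_divisor mult_div_mod_eq
        nat.simps(3) zero_less_Suc)
  show ?thesis unfolding exp_dioph_fun_def eq
    by (intro exp_dioph_intros exp_dioph_less *[THEN exp_dioph_fun_subst])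
qed

lemma exp_dioph_fun_mod: "exp_dioph_fun s \<Longrightarrow> exp_dioph_fun t \<Longrightarrow> exp_dioph_fun (\<lambda>\<rho>. s \<rho> mod Suc (t \<rho>))"
  unfolding modulo_nat_def by (intro exp_dioph_intros exp_dioph_fun_diff exp_dioph_fun_div)

lemma exp_dioph_fun_div_exp: "exp_dioph_fun s \<Longrightarrow> exp_dioph_fun t \<Longrightarrow> exp_dioph_fun (\<lambda>\<rho>. s \<rho> div 2 ^ t \<rho>)"
  using exp_dioph_fun_div[of s "\<lambda>\<rho>. 2 ^ t \<rho> - 1"] by (simp add: exp_dioph_fun_diff exp_dioph_fun_exp
      exp_dioph_fun_const)

lemma exp_dioph_fun_mod_exp: "exp_dioph_fun s \<Longrightarrow> exp_dioph_fun t \<Longrightarrow> exp_dioph_fun (\<lambda>\<rho>. s \<rho> mod 2 ^ t \<rho>)"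
  using exp_dioph_fun_mod[of s "\<lambda>\<rho>. 2 ^ t \<rho> - 1"] by (simp add: exp_dioph_fun_diff exp_dioph_fun_exp
      exp_dioph_fun_const)

lemma exp_dioph_list_Nil: "exp_dioph_list 0 (\<lambda>\<rho>. [])"
  by (simp add: exp_dioph_list_def)

lemma exp_dioph_list_Cons: "exp_dioph_fun t \<Longrightarrow> exp_dioph_list k l \<Longrightarrow> exp_dioph_list (Suc k) (\<lambda>\<rho>. t \<rho> # l \<rho>)"
  by (auto simp: exp_dioph_list_def less_Suc_eq_0_disj)

lemma exp_dioph_list_tl: "exp_dioph_list (Suc k) l \<Longrightarrow> exp_dioph_list k (\<lambda>\<rho>. tl (l \<rho>))"
  by (auto simp: exp_dioph_list_def nth_tl)

lemma exp_dioph_list_hd: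
  assumes "exp_dioph_list (Suc k) l"
  shows "exp_dioph_fun (\<lambda>\<rho>. hd (l \<rho>))"
proof -
  have "hd (l \<rho>) = l \<rho> ! 0" for \<rho>
    using assms by (intro hd_conv_nth) (metis exp_dioph_list_def length_0_conv nat.distinct(1))
  then show ?thesis using assms by (simp add: exp_dioph_list_def)
qed

lemma exp_dioph_list_nth: "exp_dioph_list k l \<Longrightarrow> i < k \<Longrightarrow> exp_dioph_fun (\<lambda>\<rho>. l \<rho> ! i)"
  by (simp add: exp_dioph_list_def)

lemma exp_dioph_list_vars: "exp_dioph_list k (\<lambda>\<rho>. map (\<lambda>i. \<rho> (f i)) [0..<k])"
  by (auto simp: exp_dioph_list_def exp_dioph_fun_var)

lemma exp_dioph_list_subst: "exp_dioph_list k l \<Longrightarrow> exp_dioph_list k (\<lambda>\<rho>. l (\<lambda>i. \<rho> (f i)))"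
  by (auto simp: exp_dioph_list_def intro: exp_dioph_fun_subst)

lemma exp_dioph_ex_list:
  assumes "exp_dioph (\<lambda>\<rho>. P (map (\<lambda>i. \<rho> i) [0..<k]) (\<lambda>i. \<rho> (i + k)))"
  shows "exp_dioph (\<lambda>\<rho>. \<exists>l. length l = k \<and> P l \<rho>)"
  using assms
proof (induction k arbitrary: P)
  case 0
  then show ?case by simp
next
  case (Suc k)
  have eq: "(\<exists>l. length l = Suc k \<and> P l \<rho>) \<longleftrightarrow> (\<exists>l. length l = k \<and> (\<exists>x. P (x # l) \<rho>))" for \<rho>
    by (auto simp: length_Suc_conv)
  show ?case unfolding eq
  proof (rule Suc.IH, rule exp_dioph_ex)
    have [simp]: "\<rho> 0 # map (\<lambda>i. \<rho> (Suc i)) [0..<k] = map \<rho> [0..<Suc k]" for \<rho> :: "nat \<Rightarrow> nat"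
      by (simp add: upt_conv_Cons map_Suc_upt[symmetric] comp_def del: upt_Suc)
    show "exp_dioph (\<lambda>\<rho>. P (\<rho> 0 # map (\<lambda>i. \<rho> (Suc i)) [0..<k]) (\<lambda>i. \<rho> (Suc (i + k))))"
      using Suc.prems by simp
  qed
qed

lemma exp_dioph_all_less: "(\<And>i. i < k \<Longrightarrow> exp_dioph (P i)) \<Longrightarrow> exp_dioph (\<lambda>\<rho>. \<forall>i < k. P i \<rho>)" for k :: nat
proof (induction k)
  case (Suc k)
  have "exp_dioph (\<lambda>\<rho>. (\<forall>i < k. P i \<rho>) \<and> P k \<rho>)"
    using Suc by (intro exp_dioph_conj) auto
  then show ?case by (simp add: less_Suc_eq conj_disj_distribL all_conj_distrib imp_conjR disj_imp
        flip: conj_commute) (auto elim!: back_subst[of exp_dioph] simp: fun_eq_iff less_Suc_eq)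
qed (simp add: exp_dioph_const)

subsection \<open>Digits and bit masks\<close>

definition dig :: "nat \<Rightarrow> nat \<Rightarrow> nat \<Rightarrow> nat" where
  "dig b X i = X div b ^ i mod b"

lemma dig_0: "dig b X 0 = X mod b"
  by (simp add: dig_def)

lemma dig_Suc: "dig b X (Suc i) = dig b (X div b) i"
  by (simp add: dig_def div_mult2_eq)

lemma dig_zero [simp]: "dig b 0 i = 0"
  by (simp add: dig_def)

lemma dig_sum_lessThan:
  "\<forall>i < n. v i < b \<Longrightarrow> dig b (\<Sum>i<n. v i * b ^ i) j = (if j < n then v j else 0)"
proof (induction n arbitrary: v j)
  case (Suc n)
  have "(\<Sum>i<Suc n. v i * b ^ i) = v 0 + b * (\<Sum>i<n. v (Suc i) * b ^ i)"
    by (simp add: sum.lessThan_Suc_shift sum_distrib_left mult_ac del: sum.lessThan_Suc)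
  moreover have "v 0 < b" using Suc.prems by simp
  moreover have "dig b (\<Sum>i<n. v (Suc i) * b ^ i) k = (if k < n then v (Suc k) else 0)" for k
    using Suc.IH[of "\<lambda>i. v (Suc i)" k] Suc.prems by simp
  ultimately show ?case by (cases j) (simp_all add: dig_0 dig_Suc)
qed simp

lemma sum_dig: "b > 0 \<Longrightarrow> X < b ^ n \<Longrightarrow> (\<Sum>i<n. dig b X i * b ^ i) = X"
proof (induction n arbitrary: X)
  case (Suc n)
  have "X div b < b ^ n"
    using Suc.prems by (simp add: less_mult_imp_div_less mult.commute)
  then have "(\<Sum>i<n. dig b (X div b) i * b ^ i) = X div b"
    using Suc by simp
  then have "X = dig b X 0 + b * (\<Sum>i<n. dig b X (Suc i) * b ^ i)"
    by (simp add: dig_0 dig_Suc)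
  then show ?case
    by (simp add: sum.lessThan_Suc_shift sum_distrib_left mult_ac del: sum.lessThan_Suc)
qed simp

lemma dig_eq_0: "X < b ^ i \<Longrightarrow> dig b X i = 0"
  by (simp add: dig_def)

lemma less_power_self: "b \<ge> 2 \<Longrightarrow> X \<le> n \<Longrightarrow> X < b ^ n" for b X n :: nat
  using power_gt_expt[of b n] by linarith

lemma dig_add:
  assumes "b \<ge> 2" "\<And>i. dig b X i + dig b Y i < b"
  shows "dig b (X + Y) i = dig b X i + dig b Y i"
proof -
  \<comment> \<open>Since \<open>X < b ^ n\<close> for \<open>X \<le> n\<close>, this bound exceeds
    the lengths of both expansions, and also the position \<open>i\<close>.\<close>
  define n where "n = X + Y + i + 1"
  have *: "X = (\<Sum>i<n. dig b X i * b ^ i)" "Y = (\<Sum>i<n. dig b Y i * b ^ i)"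
    using sum_dig[of b _ n] assms(1) less_power_self[of b _ n] by (simp_all add: n_def)
  have "X + Y = (\<Sum>i<n. (dig b X i + dig b Y i) * b ^ i)"
    using * by (simp add: add_mult_distrib sum.distrib)
  then show ?thesis
    using dig_sum_lessThan[of n "\<lambda>i. dig b X i + dig b Y i" b i] assms(2) by (simp add: n_def)
qed

lemma dig_mult:
  assumes "b \<ge> 2" "\<And>i. c * dig b X i < b"
  shows "dig b (c * X) i = c * dig b X i"
proof -
  define n where "n = X + i + 1"
  have *: "X = (\<Sum>i<n. dig b X i * b ^ i)"
    using sum_dig[of b _ n] assms(1) less_power_self[of b _ n] by (simp_all add: n_def)
  have "c * X = (\<Sum>i<n. (c * dig b X i) * b ^ i)"
    by (subst *) (simp add: sum_distrib_left mult_ac)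
  then show ?thesis
    using dig_sum_lessThan[of n "\<lambda>i. c * dig b X i" b i] assms(2) by (simp add: n_def)
qed

lemma dig_shift:
  assumes "b > 0"
  shows "dig b (b ^ d * X) i = (if i < d then 0 else dig b X (i - d))"
proof (cases "i < d")
  case True
  then have "b ^ d = b ^ i * (b * b ^ (d - Suc i))"
    by (metis Suc_leI le_add_diff_inverse power_Suc power_add mult.assoc add_Suc_right add_Suc)
  then show ?thesis
    using True assms by (simp add: dig_def mult.assoc)
next
  case False
  then have "b ^ i = b ^ d * b ^ (i - d)"
    by (simp flip: power_add)
  then show ?thesis
    using False assms by (simp add: dig_def)
qed

definition pack :: "nat \<Rightarrow> nat set \<Rightarrow> (nat \<Rightarrow> nat) \<Rightarrow> nat" where
  "pack b S v = (\<Sum>i \<in> S. v i * b ^ i)"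

lemma dig_pack:
  assumes "finite S" "\<And>i. i \<in> S \<Longrightarrow> v i < b"
  shows "dig b (pack b S v) j = (if j \<in> S then v j else 0)"
proof (cases "b = 0")
  case True
  then have "S = {}" using assms(2) by auto
  then show ?thesis by (simp add: pack_def)
next
  case False
  obtain n where n: "S \<subseteq> {..<n}"
    using assms(1) finite_nat_set_iff_bounded by auto
  have "pack b S v = (\<Sum>i<n. (if i \<in> S then v i else 0) * b ^ i)"
    unfolding pack_def by (rule sum.mono_neutral_cong_left) (use n in auto)
  then show ?thesis
    using dig_sum_lessThan[of n "\<lambda>i. if i \<in> S then v i else 0" b j] assms(2) False n by auto
qed

lemma pack_add: "pack b S (\<lambda>i. v i + w i) = pack b S v + pack b S w"
  by (simp add: pack_def add_mult_distrib sum.distrib)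

lemma pack_cong: "(\<And>i. i \<in> S \<Longrightarrow> v i = w i) \<Longrightarrow> pack b S v = pack b S w"
  by (simp add: pack_def)

section \<open>Bitwise comparison through parities of binomial coefficients\<close>

definition submask :: "nat \<Rightarrow> nat \<Rightarrow> bool" where
  "submask r s \<longleftrightarrow> (\<forall>k. bit r k \<longrightarrow> bit s k)"

lemma choose_Suc_Suc2:
  "Suc (Suc m) choose Suc (Suc k) = (m choose k) + 2 * (m choose Suc k) + (m choose Suc (Suc k))"
  by simp

text \<open>Coefficients of \<open>(1 + x) ^ (2 * n)\<close>, which is \<open>(1 + x^2) ^ n\<close>
  modulo two; the induction uses Pascal's rule twice, where the middle term is even.\<close>

lemma choose_double_parity:
  "even (2 * n choose Suc (2 * k)) \<and> (odd (2 * n choose (2 * k)) \<longleftrightarrow> odd (n choose k))"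
proof (induction n arbitrary: k)
  case 0
  show ?case by (cases k) simp_all
next
  case (Suc n)
  show ?case
  proof (cases k)
    case 0
    then show ?thesis by simp
  next
    case k: (Suc j)
    have "2 * Suc n = Suc (Suc (2 * n))" "2 * Suc j = Suc (Suc (2 * j))" by simp_all
    then show ?thesis
      using Suc[of j] Suc[of "Suc j"]
      by (simp only: k choose_Suc_Suc2 even_add even_mult_iff binomial_Suc_Suc[of n j]) simp
  qed
qed

text \<open>One binary digit of Lucas's theorem for the prime two; \<open>submask\<close> satisfies
  the same recursion.\<close>

lemma odd_choose_rec:
  "odd (n choose k) \<longleftrightarrow> (odd k \<longrightarrow> odd n) \<and> odd (n div 2 choose (k div 2))"
proof -
  have 1: "odd (Suc (2 * n) choose Suc (2 * k)) \<longleftrightarrow> odd (n choose k)" for n k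
    using choose_double_parity[of n k] by simp
  have 2: "odd (Suc (2 * n) choose (2 * k)) \<longleftrightarrow> odd (n choose k)" for n k
  proof (cases k)
    case (Suc j)
    then have "Suc (2 * n) choose (2 * k) = (2 * n choose Suc (2 * j)) + (2 * n choose (2 * k))"
      by simp
    then show ?thesis
      using choose_double_parity[of n j] choose_double_parity[of n k] by simp
  qed simp
  have "n = 2 * (n div 2) \<or> n = Suc (2 * (n div 2))" by presburger
  moreover have "k = 2 * (k div 2) \<or> k = Suc (2 * (k div 2))" by presburger
  ultimately show ?thesis
    using 1[of "n div 2" "k div 2"] 2[of "n div 2" "k div 2"]
      choose_double_parity[of "n div 2" "k div 2"]
    by (elim disjE; metis even_Suc even_mult_iff dvd_refl)
qed

lemma submask_rec: "submask r s \<longleftrightarrow> (odd r \<longrightarrow> odd s) \<and> submask (r div 2) (s div 2)"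
  unfolding submask_def by (metis bit_0 bit_Suc not0_implies_Suc)

lemma odd_choose_iff_submask: "odd (s choose r) \<longleftrightarrow> submask r s"
proof (induction s arbitrary: r rule: less_induct)
  case (less s)
  show ?case
  proof (cases "s = 0")
    case True
    have "submask r 0 \<longleftrightarrow> r = 0"
      by (auto simp: submask_def bit_eq_iff)
    then show ?thesis
      using True by (cases r) auto
  next
    case False
    then show ?thesis
      using less.IH[of "s div 2" "r div 2"] odd_choose_rec[of s r] submask_rec[of r s] by simp
  qed
qed

text \<open>
  The binomial coefficient is a digit of \<open>(1 + u) ^ s\<close> in base \<open>u\<close>.  That power is reduced to a
  power of two by computing modulo \<open>m = 2 ^ x - (1 + u)\<close>, where \<open>2 ^ x\<close> and \<open>1 + u\<close> are congruent.
\<close>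

lemma choose_eq_dig:
  fixes r s :: nat
  defines "u \<equiv> 2 ^ (s + 1)"
  defines "m \<equiv> 2 ^ ((s + 2) * (s + 2)) - (1 + u)"
  shows "m > 0" "s choose r = 2 ^ ((s + 2) * (s + 2) * s) mod m div u ^ r mod u"
proof -
  \<comment> \<open>The estimates aim at \<open>(1 + u) ^ s < m\<close>: then the residue of the
    power of two modulo \<open>m\<close> is \<open>(1 + u) ^ s\<close> itself.\<close>
  have "1 + u \<le> 2 * u" by (simp add: u_def)
  then have u: "1 + u \<le> 2 ^ (s + 2)" by (simp add: u_def)
  then have "(1 + u) ^ s \<le> (2 ^ (s + 2)) ^ s" by (rule power_mono) simp
  also have "\<dots> \<le> 2 ^ ((s + 2) * (s + 1))"
    unfolding power_mult[symmetric] by (rule power_increasing) auto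
  finally have 1: "(1 + u) ^ s \<le> 2 ^ ((s + 2) * (s + 1))" .
  have "(2::nat) ^ (s + 2) \<le> 2 ^ ((s + 2) * (s + 1))"
    by (rule power_increasing) auto
  with u 1 have "(1 + u) ^ s + (1 + u) \<le> 2 * 2 ^ ((s + 2) * (s + 1))" by linarith
  also have "\<dots> < 2 ^ (s + 2) * 2 ^ ((s + 2) * (s + 1))"
    using power_strict_increasing[of 1 "s + 2" "2::nat"] by (intro mult_strict_right_mono) simp_all
  also have "\<dots> = 2 ^ ((s + 2) * (s + 2))"
    unfolding power_add[symmetric] by (rule arg_cong[where f = "power 2"]) (simp add: algebra_simps)
  finally have less: "(1 + u) ^ s < m" and "1 + u < 2 ^ ((s + 2) * (s + 2))"
    by (simp_all add: m_def)
  then have eq: "2 ^ ((s + 2) * (s + 2)) = m + (1 + u)" by (simp add: m_def)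
  show "m > 0" using less by simp
  have "2 ^ ((s + 2) * (s + 2) * s) mod m = (m + (1 + u)) ^ s mod m"
    unfolding power_mult[of 2 "(s + 2) * (s + 2)"] eq ..
  also have "\<dots> = (1 + u) ^ s mod m"
    by (metis mod_add_self1 power_mod)
  also have "\<dots> = (1 + u) ^ s"
    using less by simp
  also have "\<dots> = (\<Sum>i<Suc s. (s choose i) * u ^ i)"
    using binomial[of u 1 s] by (simp add: lessThan_Suc_atMost)
  finally have "2 ^ ((s + 2) * (s + 2) * s) mod m div u ^ r mod u
    = dig u (\<Sum>i<Suc s. (s choose i) * u ^ i) r"
    by (simp add: dig_def)
  also have "\<dots> = s choose r"
  proof -
    have "(2::nat) ^ s < u" by (simp add: u_def)
    \<comment> \<open>All coefficients are at most \<open>2 ^ s\<close>, so the binomial expansion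
      in \<open>u\<close> is a base \<open>u\<close> expansion without carries.\<close>
    then have "\<forall>i < Suc s. s choose i < u"
      using binomial_le_pow2[of s] le_less_trans by blast
    then show ?thesis
      by (simp only: dig_sum_lessThan) (simp add: binomial_eq_0)
  qed
  finally show "s choose r = 2 ^ ((s + 2) * (s + 2) * s) mod m div u ^ r mod u" by simp
qed

lemma exp_dioph_submask:
  assumes "exp_dioph_fun r" "exp_dioph_fun s"
  shows "exp_dioph (\<lambda>\<rho>. submask (r \<rho>) (s \<rho>))"
proof -
  \<comment> \<open>The formula for the binomial coefficient in the shape of the division rules: the
    positive modulus \<open>m\<close> appears as \<open>Suc (m - 1)\<close>.\<close>
  have eq: "odd (s choose r) \<longleftrightarrow> (2 ^ ((s + 2) * (s + 2) * s)
      mod Suc (2 ^ ((s + 2) * (s + 2)) - (1 + 2 ^ (s + 1)) - 1) div 2 ^ ((s + 1) * r)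
      mod 2 ^ (s + 1)) mod Suc 1 = 1" for r s :: nat
  proof -
    define m where "m = 2 ^ ((s + 2) * (s + 2)) - (1 + 2 ^ (s + 1) :: nat)"
    have "Suc (m - 1) = m"
      using choose_eq_dig(1)[of s] unfolding m_def by simp
    then have "2 ^ ((s + 2) * (s + 2) * s) mod Suc (m - 1) div 2 ^ ((s + 1) * r) mod 2 ^ (s + 1)
      = s choose r"
      using choose_eq_dig(2)[of s r] by (simp only: m_def power_mult)
    moreover have "odd c \<longleftrightarrow> c mod Suc 1 = 1" for c :: nat
      by presburger
    ultimately show ?thesis
      unfolding m_def by (simp only:)
  qed
  show ?thesis
    unfolding odd_choose_iff_submask[symmetric] eq
    by (intro exp_dioph_intros exp_dioph_fun_mod exp_dioph_fun_mod_exp exp_dioph_fun_div_exp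
        exp_dioph_fun_diff assms)
qed

lemma dig_exp_bits: "dig (2 ^ p) X i = take_bit p (drop_bit (p * i) X)"
  by (simp add: dig_def take_bit_eq_mod drop_bit_eq_div power_mult)

text \<open>In a base that is a power of two, a digit is a block of \<open>p\<close> bits, so
  bitwise comparison decomposes into digits.\<close>

lemma submask_iff_dig:
  assumes "p > 0"
  shows "submask X Y \<longleftrightarrow> (\<forall>i. submask (dig (2 ^ p) X i) (dig (2 ^ p) Y i))"
proof
  assume "submask X Y"
  then show "\<forall>i. submask (dig (2 ^ p) X i) (dig (2 ^ p) Y i)"
    by (auto simp: submask_def dig_exp_bits bit_take_bit_iff bit_drop_bit_eq)
next
  assume *: "\<forall>i. submask (dig (2 ^ p) X i) (dig (2 ^ p) Y i)"
  have "bit Y k" if "bit X k" for k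
    using *[rule_format, of "k div p", unfolded submask_def, rule_format, of "k mod p"] that assms
    by (simp add: dig_exp_bits bit_take_bit_iff bit_drop_bit_eq)
  then show "submask X Y" by (simp add: submask_def)
qed

lemma submask_mask: "submask x (2 ^ m - 1) \<longleftrightarrow> x < 2 ^ m"
proof -
  have "submask x (2 ^ m - 1) \<longleftrightarrow> take_bit m x = x"
    unfolding mask_eq_exp_minus_1[symmetric] submask_def bit_eq_iff bit_take_bit_iff
    by (auto simp: bit_mask_iff)
  then show ?thesis by (simp add: take_bit_nat_eq_self_iff)
qed

lemma submask_0: "submask x 0 \<longleftrightarrow> x = 0"
  using submask_mask[of x 0] by simp

lemma submask_1: "submask x (Suc 0) \<longleftrightarrow> x \<le> 1"
  using submask_mask[of x 1] by (auto simp: numeral_2_eq_2)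

subsection \<open>Computations on all digits at once\<close>

text \<open>
  Stored digits stay below half of the base, so that two of them can be added without a carry.
\<close>

definition half :: "nat \<Rightarrow> nat" where
  "half q = 2 ^ (q + 1)"

definition base :: "nat \<Rightarrow> nat" where
  "base q = 2 ^ (q + 2)"

abbreviation digit :: "nat \<Rightarrow> nat \<Rightarrow> nat \<Rightarrow> nat" where
  "digit q \<equiv> dig (base q)"

lemma base_eq: "base q = 2 * half q"
  by (simp add: base_def half_def)

lemma half_ge: "half q \<ge> 2" "q < half q"
proof -
  have "2 ^ 1 \<le> (2 ^ (q + 1) :: nat)" by (rule power_increasing) auto
  then show "half q \<ge> 2" by (simp add: half_def)
  have "2 ^ q \<le> (2 ^ (q + 1) :: nat)" by simp
  with less_exp[of q] show "q < half q" unfolding half_def by linarith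
qed

lemma base_ge: "base q \<ge> 4" "base q > 0" "base q \<ge> 2"
  using half_ge(1)[of q] by (simp_all add: base_eq)

text \<open>The equation makes \<open>J\<close> the repunit \<open>1 + b + ... + b ^ (L - 1)\<close>
  for \<open>b = base q\<close>, and a number below it bitwise has only digits \<open>0\<close> and
  \<open>1\<close>.\<close>

definition is_mask :: "nat \<Rightarrow> nat \<Rightarrow> bool" where
  "is_mask q M \<longleftrightarrow> (\<exists>L J. J * (base q - 1) + 1 = base q ^ L \<and> submask M J)"

text \<open>\<open>half q - 1\<close> consists of \<open>q + 1\<close> binary ones. One bitwise
  comparison thus bounds all digits of \<open>X\<close> by \<open>half q\<close> and clears those
  that a mask \<open>M\<close> does not mark.\<close>

definition supp :: "nat \<Rightarrow> nat \<Rightarrow> nat \<Rightarrow> bool" where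
  "supp q M X \<longleftrightarrow> submask X ((half q - 1) * M)"

lemma geometric_sum_nat: "b \<ge> 1 \<Longrightarrow> (\<Sum>i<L. b ^ i) * (b - 1) + 1 = b ^ L" for b :: nat
proof (induction L)
  case (Suc L)
  obtain c where "b = Suc c" using Suc.prems by (cases b) auto
  then show ?case using Suc by (simp add: algebra_simps)
qed simp

lemma submask_iff_digit: "submask X Y \<longleftrightarrow> (\<forall>i. submask (digit q X i) (digit q Y i))"
  unfolding base_def by (rule submask_iff_dig) simp

lemma is_mask_iff: "is_mask q M \<longleftrightarrow> (\<forall>i. digit q M i \<le> 1)"
proof -
  have J: "digit q (\<Sum>i<L. base q ^ i) i = (if i < L then 1 else 0)" for L i
    using dig_sum_lessThan[of L "\<lambda>_. 1" "base q" i] base_ge[of q] by simp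
  show ?thesis
  proof
    assume "is_mask q M"
    then obtain L J where LJ: "J * (base q - 1) + 1 = base q ^ L" "submask M J"
      unfolding is_mask_def by blast
    have "J * (base q - 1) = (\<Sum>i<L. base q ^ i) * (base q - 1)"
      using LJ(1) geometric_sum_nat[of "base q" L] base_ge(1)[of q] by linarith
    then have "J = (\<Sum>i<L. base q ^ i)"
      using base_ge(1)[of q] by simp
    then show "\<forall>i. digit q M i \<le> 1"
      using LJ(2)[THEN submask_iff_digit[THEN iffD1], rule_format, of q] J[of L]
      by (metis One_nat_def submask_0 submask_1 zero_le)
  next
    assume *: "\<forall>i. digit q M i \<le> 1"
    have "digit q M i = 0" if "\<not> i < M" for i
      using that less_power_self[of "base q" M i] base_ge[of q] by (intro dig_eq_0) auto
    \<comment> \<open>A repunit of length \<open>M\<close> is long enough, as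
      \<open>M < base q ^ M\<close>.\<close>
    then have "submask M (\<Sum>i<M. base q ^ i)"
      using * by (subst submask_iff_digit[of _ _ q]) (auto simp: J submask_0 submask_1)
    then show "is_mask q M"
      using geometric_sum_nat[of "base q" M] base_ge(1)[of q] unfolding is_mask_def by auto
  qed
qed

lemma is_maskD: "is_mask q M \<Longrightarrow> digit q M i = 0 \<or> digit q M i = 1"
  unfolding is_mask_iff by (metis One_nat_def le_SucE le_zero_eq)

lemma supp_iff:
  assumes "is_mask q M"
  shows "supp q M X \<longleftrightarrow> (\<forall>i. digit q X i < half q \<and> (digit q M i = 0 \<longrightarrow> digit q X i = 0))"
proof -
  have dig: "digit q ((half q - 1) * M) i = (half q - 1) * digit q M i" for i
  proof (rule dig_mult)
    show "(half q - 1) * digit q M i < base q" for i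
      using is_maskD[OF assms, of i] half_ge[of q] by (auto simp: base_eq)
  qed (rule base_ge)
  have "submask (digit q X i) ((half q - 1) * digit q M i) \<longleftrightarrow>
      digit q X i < half q \<and> (digit q M i = 0 \<longrightarrow> digit q X i = 0)" for i
    using is_maskD[OF assms, of i] half_ge[of q] submask_mask[of "digit q X i" "q + 1"]
    by (auto simp: submask_0 half_def)
  then show ?thesis
    unfolding supp_def by (subst submask_iff_digit[of _ _ q]) (simp only: dig)
qed

lemma supp_digit_less: "is_mask q M \<Longrightarrow> supp q M X \<Longrightarrow> digit q X i < half q"
  by (simp add: supp_iff)

lemma supp_digit_0: "is_mask q M \<Longrightarrow> supp q M X \<Longrightarrow> digit q M i = 0 \<Longrightarrow> digit q X i = 0"
  by (simp add: supp_iff)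

lemma digit_add_half:
  "(\<And>i. digit q X i < half q) \<Longrightarrow> (\<And>i. digit q Y i < half q) \<Longrightarrow>
    digit q (X + Y) i = digit q X i + digit q Y i"
  by (rule dig_add[OF base_ge(3)]) (metis add_strict_mono base_eq mult_2)

lemma is_mask_less_half: "is_mask q M \<Longrightarrow> digit q M i < half q"
  using is_maskD[of q M i] half_ge[of q] by auto

lemma digit_shift: "digit q (base q ^ d * X) i = (if i < d then 0 else digit q X (i - d))"
  by (rule dig_shift) (rule base_ge)

text \<open>
  The digits marked by \<open>M\<close> start runs of digits with step \<open>d\<close>: \<open>S\<close> marks the digits of a run except
  the last one, and \<open>E\<close> marks the last one.  That \<open>S + E\<close> is a mask keeps the runs disjoint.
  A \<open>link\<close> stores a sequence of values along every run: \<open>A\<close> and \<open>Z\<close> have the first and the last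
  value, \<open>W\<close> has at each position in \<open>S\<close> the current value and \<open>V\<close> the next one.
\<close>

definition chain :: "nat \<Rightarrow> nat \<Rightarrow> nat \<Rightarrow> nat \<Rightarrow> nat \<Rightarrow> bool" where
  "chain q d M S E \<longleftrightarrow>
    is_mask q S \<and> is_mask q E \<and> is_mask q (S + E) \<and> M + base q ^ d * S = S + E"

definition link :: "nat \<Rightarrow> nat \<Rightarrow> nat \<Rightarrow> nat \<Rightarrow> nat \<Rightarrow> nat \<Rightarrow> nat \<Rightarrow> nat \<Rightarrow> nat \<Rightarrow> bool" where
  "link q d M S E A V W Z \<longleftrightarrow>
    supp q M A \<and> supp q S V \<and> supp q S W \<and> supp q E Z \<and> A + base q ^ d * V = W + Z"

text \<open>Multiplication by \<open>base q ^ d\<close> moves digits up by \<open>d\<close>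
  positions. All digits involved are below \<open>half q\<close>, so neither side produces a carry
  and the equation can be read digit by digit.\<close>

lemma chain_digits:
  assumes "is_mask q M" "chain q d M S E"
  shows "digit q M i + (if i < d then 0 else digit q S (i - d)) = digit q S i + digit q E i"
    and "digit q S i + digit q E i \<le> 1"
    and "digit q (S + E) i = digit q S i + digit q E i"
proof -
  have S: "is_mask q S" and E: "is_mask q E" and SE: "is_mask q (S + E)"
    and eq: "M + base q ^ d * S = S + E"
    using assms(2) by (auto simp: chain_def)
  show 1: "digit q (S + E) i = digit q S i + digit q E i"
    by (rule digit_add_half) (simp_all add: S E is_mask_less_half)
  have "digit q (M + base q ^ d * S) i = digit q M i + digit q (base q ^ d * S) i"
    using half_ge[of q] by (intro digit_add_half) (auto simp: digit_shift S assms(1) is_mask_less_half)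
  then show "digit q M i + (if i < d then 0 else digit q S (i - d)) = digit q S i + digit q E i"
    using 1 by (simp add: eq digit_shift)
  show "digit q S i + digit q E i \<le> 1"
    using SE 1 unfolding is_mask_iff by metis
qed

lemma link_digits:
  assumes "is_mask q M" "chain q d M S E" "link q d M S E A V W Z"
  shows "digit q A i + (if i < d then 0 else digit q V (i - d)) = digit q W i + digit q Z i"
proof -
  have S: "is_mask q S" and E: "is_mask q E"
    using assms(2) by (auto simp: chain_def)
  have eq: "A + base q ^ d * V = W + Z"
    using assms(3) by (auto simp: link_def)
  have less: "digit q A i < half q" "digit q V i < half q" "digit q W i < half q" "digit q Z i <
      half q" for i
    using assms(1,3) S E by (auto simp: link_def intro: supp_digit_less)
  have "digit q (A + base q ^ d * V) i = digit q A i + digit q (base q ^ d * V) i"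
    using half_ge[of q] less by (intro digit_add_half) (auto simp: digit_shift)
  moreover have "digit q (W + Z) i = digit q W i + digit q Z i"
    using less by (intro digit_add_half) auto
  ultimately show ?thesis
    by (simp add: eq digit_shift)
qed

lemma supp_union:
  assumes "is_mask q M" "chain q d M S E" "supp q S X" "supp q E Z"
  shows "supp q (S + E) (X + Z)" "digit q (X + Z) i = digit q X i + digit q Z i"
proof -
  have S: "is_mask q S" and E: "is_mask q E" and SE: "is_mask q (S + E)"
    using assms(2) by (auto simp: chain_def)
  note X = assms(3)[unfolded supp_iff[OF S], rule_format]
  note Z = assms(4)[unfolded supp_iff[OF E], rule_format]
  show *: "digit q (X + Z) i = digit q X i + digit q Z i" for i
    using X Z by (intro digit_add_half) auto
  have "digit q S i = 0 \<or> digit q E i = 0" for i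
    using chain_digits(2)[OF assms(1,2), of i] by auto
  then show "supp q (S + E) (X + Z)"
    unfolding supp_iff[OF SE] * chain_digits(3)[OF assms(1,2)] using X Z
    by (metis add.right_neutral add_eq_0_iff_both_eq_0 add_0)
qed

text \<open>A mark of \<open>S\<close> at a position forces a mark of \<open>S\<close> or
  \<open>E\<close> at the position \<open>d\<close> higher. Following the marks from
  \<open>t\<close> must end, since \<open>S\<close> has finitely many digits, and it can end only in
  \<open>E\<close>. The length \<open>n\<close> depends on the chain alone and so is common to all
  its links.\<close>

lemma chain_run:
  assumes M: "is_mask q M" and chain: "chain q d M S E" and d: "d > 0" and t: "digit q M t = 1"
  obtains n where
    "\<And>j. j < n \<Longrightarrow> digit q S (t + d * j) = 1"
    "digit q E (t + d * n) = 1"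
    "\<And>A V W Z. link q d M S E A V W Z \<Longrightarrow>
      \<exists>a. a 0 = digit q A t \<and> (\<forall>j < n. a j = digit q W (t + d * j) \<and> a (Suc j) = digit q V (t + d * j))
        \<and> a n = digit q Z (t + d * n)"
proof -
  have S: "is_mask q S" and E: "is_mask q E"
    using chain by (auto simp: chain_def)
  note step = chain_digits(1)[OF M chain] and le = chain_digits(2)[OF M chain]
  \<comment> \<open>\<open>S\<close> has no nonzero digit at a position from \<open>S\<close> on,
    because \<open>S < base q ^ S\<close>.\<close>
  have "digit q S (t + d * S) = 0"
    using less_power_self[of "base q" S "t + d * S"] base_ge[of q] d
    by (intro dig_eq_0) (simp add: trans_le_add2)
  then have ex: "\<exists>j. digit q S (t + d * j) \<noteq> 1" by (metis zero_neq_one)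
  define n where "n = (LEAST j. digit q S (t + d * j) \<noteq> 1)"
  have run: "digit q S (t + d * j) = 1" if "j < n" for j
    using not_less_Least[OF that[unfolded n_def]] by simp
  have "digit q S (t + d * n) \<noteq> 1"
    unfolding n_def by (rule LeastI_ex[OF ex])
  then have S_end: "digit q S (t + d * n) = 0"
    using is_maskD[OF S] by metis
  have on: "digit q S (t + d * j) + digit q E (t + d * j) = 1" if "j \<le> n" for j
  proof (cases j)
    case 0
    then show ?thesis using step[of t] le[of t] t by simp
  next
    case (Suc i)
    then have "digit q S (t + d * i) = 1" using run that by simp
    then show ?thesis
      using step[of "t + d * j"] le[of "t + d * j"] Suc by (simp split: if_splits)
  qed
  have E_end: "digit q E (t + d * n) = 1"
    using on[of n] S_end by simp
  have E_run: "digit q E (t + d * j) = 0" if "j < n" for j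
    using on[of j] run[of j] that by simp
  have "\<exists>a. a 0 = digit q A t \<and> (\<forall>j < n. a j = digit q W (t + d * j) \<and> a (Suc j) = digit q V (t + d * j))
        \<and> a n = digit q Z (t + d * n)" if link: "link q d M S E A V W Z" for A V W Z
  proof (intro exI conjI allI impI)
    note lstep = link_digits[OF M chain link]
    have A: "\<And>i. digit q M i = 0 \<Longrightarrow> digit q A i = 0"
      and V: "\<And>i. digit q S i = 0 \<Longrightarrow> digit q V i = 0"
      and W: "\<And>i. digit q S i = 0 \<Longrightarrow> digit q W i = 0"
      and Z: "\<And>i. digit q E i = 0 \<Longrightarrow> digit q Z i = 0"
      using link M S E supp_digit_0 by (auto simp: link_def)
    \<comment> \<open>Only one summand can be nonzero: \<open>W\<close> before the end of the run
      and \<open>Z\<close> at its end.\<close>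
    let ?a = "\<lambda>j. digit q W (t + d * j) + digit q Z (t + d * j)"
    \<comment> \<open>A position has room for one mark, and the start mark at \<open>t\<close> takes
      it, so no other run leads into \<open>t\<close>.\<close>
    have "digit q S (t - d) = 0" if "\<not> t < d"
      using step[of t] le[of t] t that by simp
    then show "?a 0 = digit q A t"
      using lstep[of t] V by (auto split: if_splits)
    show "?a n = digit q Z (t + d * n)"
      using W S_end by simp
    fix j assume j: "j < n"
    show "?a j = digit q W (t + d * j)"
      using Z E_run[OF j] by simp
    have "digit q M (t + d * Suc j) = 0"
      using step[of "t + d * Suc j"] le[of "t + d * Suc j"] run[OF j] by simp
    then show "?a (Suc j) = digit q V (t + d * j)"
      using lstep[of "t + d * Suc j"] A by simp
  qed
  with run E_end show thesis by (rule that)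
qed

text \<open>The counting link identifies \<open>n\<close> with a stored digit: its next value
  \<open>K + S\<close> is one more than \<open>K\<close> at each position before the end, so
  \<open>N\<close> ends with the length of the run.\<close>

lemma chain_run_basic:
  assumes M: "is_mask q M" and chain: "chain q d M S E" and d: "d > 0" and t: "digit q M t = 1"
    and count: "link q d M S E 0 (K + S) K N"
  obtains n where
    "\<forall>j < n. digit q S (t + d * j) = 1 \<and> digit q K (t + d * j) = j"
    "digit q E (t + d * n) = 1"
    "digit q N (t + d * n) = n"
    "\<forall>X P Z. link q d M S E X P P Z \<longrightarrow>
      (\<forall>j < n. digit q P (t + d * j) = digit q X t) \<and> digit q Z (t + d * n) = digit q X t"
    "\<forall>A V W Z. link q d M S E A V W Z \<longrightarrow>
      (\<exists>a. a 0 = digit q A t \<and> (\<forall>j < n. a j = digit q W (t + d * j) \<and> a (Suc j) = digit q V (t + d * j))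
        \<and> a n = digit q Z (t + d * n))"
proof -
  obtain n where n: "\<And>j. j < n \<Longrightarrow> digit q S (t + d * j) = 1" "digit q E (t + d * n) = 1"
    and run: "\<And>A V W Z. link q d M S E A V W Z \<Longrightarrow>
      \<exists>a. a 0 = digit q A t \<and> (\<forall>j < n. a j = digit q W (t + d * j) \<and> a (Suc j) = digit q V (t + d * j))
        \<and> a n = digit q Z (t + d * n)"
    using chain_run[OF M chain d t] by blast
  have S: "is_mask q S" using chain by (auto simp: chain_def)
  have "supp q S K" using count by (simp add: link_def)
  then have KS: "digit q (K + S) i = digit q K i + digit q S i" for i
    using supp_digit_less[OF S] is_mask_less_half[OF S] by (intro digit_add_half) auto
  obtain a where a: "a 0 = digit q 0 t" "a n = digit q N (t + d * n)"
    "\<And>j. j < n \<Longrightarrow> a j = digit q K (t + d * j) \<and> a (Suc j) = digit q (K + S) (t + d * j)"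
    using run[OF count] by blast
  have aj: "j \<le> n \<Longrightarrow> a j = j" for j
    by (induction j) (use a n KS in auto)
  have K: "digit q K (t + d * j) = j" if "j < n" for j
    using aj[of j] a(3)[of j] that by simp
  have N: "digit q N (t + d * n) = n"
    using aj[of n] a(2) by simp
  have const: "(\<forall>j < n. digit q P (t + d * j) = digit q X t) \<and> digit q Z (t + d * n) = digit q X t"
    if link: "link q d M S E X P P Z" for X P Z
  proof -
    obtain b where b: "b 0 = digit q X t" "b n = digit q Z (t + d * n)"
      "\<And>j. j < n \<Longrightarrow> b j = digit q P (t + d * j) \<and> b (Suc j) = digit q P (t + d * j)"
      using run[OF link] by blast
    have bj: "j \<le> n \<Longrightarrow> b j = digit q X t" for j
      by (induction j) (use b in auto)
    then show ?thesis
      using b(2,3) by (metis le_refl less_imp_le_nat)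
  qed
  show thesis
    by (rule that[of n]) (use n K N const run in blast)+
qed

text \<open>
  In a recursion or search, \<open>K\<close> counts the steps from \<open>0\<close> to \<open>N\<close>, and a \<open>link\<close> with \<open>V = W\<close> copies
  an argument or a result along the run.  The cases \<open>M = 0 \<and> Y = 0\<close> serve programs that are
  applied to the wrong number of arguments but at no position: such a program may occur in a
  computation that never calls it.
\<close>

primrec vcomputes :: "recf \<Rightarrow> nat \<Rightarrow> nat \<Rightarrow> nat list \<Rightarrow> nat \<Rightarrow> bool" where
  "vcomputes Zero = (\<lambda>q M Xs Y. Y = 0)"
| "vcomputes Succ = (\<lambda>q M Xs Y.
    if length Xs = 1 then Y = hd Xs + M \<and> supp q M Y else M = 0 \<and> Y = 0)"
| "vcomputes (Proj i) = (\<lambda>q M Xs Y.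
    if i < length Xs then Y = Xs ! i else M = 0 \<and> Y = 0)"
| "vcomputes (Comp f gs) = (\<lambda>q M Xs Y.
    \<exists>Zs. list_all2 (\<lambda>R Z. R q M Xs Z) (map vcomputes gs) Zs \<and> vcomputes f q M Zs Y)"
| "vcomputes (Prim f g) = (\<lambda>q M Xs Y. if Xs = [] then M = 0 \<and> Y = 0 else
    (\<exists>d S E K N P. chain q (Suc d) M S E \<and> link q (Suc d) M S E 0 (K + S) K N \<and>
      link q (Suc d) M S E (hd Xs) P P N \<and>
      (\<exists>Ps. length Ps = length (tl Xs) \<and> (\<exists>Zs. length Zs = length (tl Xs) \<and>
        (\<forall>i < length (tl Xs). link q (Suc d) M S E (tl Xs ! i) (Ps ! i) (Ps ! i) (Zs ! i)) \<and>
        (\<exists>A V W Z Q. vcomputes f q M (tl Xs) A \<and> vcomputes g q S (K # W # Ps) V \<and>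
          link q (Suc d) M S E A V W Z \<and> link q (Suc d) M S E Y Q Q Z)))))"
| "vcomputes (Mu f) = (\<lambda>q M Xs Y.
    (\<exists>d S E K N P. chain q (Suc d) M S E \<and> link q (Suc d) M S E 0 (K + S) K N \<and>
      link q (Suc d) M S E Y P P N \<and>
      (\<exists>Ps. length Ps = length Xs \<and> (\<exists>Zs. length Zs = length Xs \<and>
        (\<forall>i < length Xs. link q (Suc d) M S E (Xs ! i) (Ps ! i) (Ps ! i) (Zs ! i)) \<and>
        (\<exists>V. supp q S V \<and> supp q S (V + S) \<and>
          vcomputes f q (S + E) ((K + N) # map2 (+) Ps Zs) (V + S))))))"

text \<open>\<open>supp q M Y\<close> belongs to the induction claim because \<open>Y\<close> may be
  an argument of another program, where it excludes carries and digits at unmarked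
  positions.\<close>

lemma vcomputes_sound:
  assumes "vcomputes f q M Xs Y" "is_mask q M" "\<forall>X \<in> set Xs. supp q M X"
  shows "supp q M Y \<and> (\<forall>t. digit q M t = 1 \<longrightarrow>
    computes f (map (\<lambda>X. digit q X t) Xs) (digit q Y t))"
  using assms
proof (induction f arbitrary: M Xs Y)
  case Zero
  then show ?case by (auto simp: supp_iff half_def intro: computes_Zero)
next
  case Succ
  show ?case
  proof (cases "length Xs = 1")
    case True
    with Succ obtain X where X: "Xs = [X]" "Y = X + M" "supp q M Y" "supp q M X"
      by (cases Xs) auto
    have "digit q Y t = digit q X t + digit q M t" for t
      unfolding X using Succ.prems(2) X(4)
      by (intro digit_add_half) (auto intro: supp_digit_less is_mask_less_half)
    then show ?thesis
      using X by (auto intro: computes_Succ)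
  next
    case False
    then show ?thesis using Succ by (simp add: supp_def submask_0)
  qed
next
  case (Proj i)
  then show ?case
    using computes_Proj[of i "map (\<lambda>X. digit q X _) Xs"]
    by (cases "i < length Xs") (auto simp: supp_def submask_0)
next
  case (Comp f gs)
  then obtain Zs where Zs: "list_all2 (\<lambda>g Z. vcomputes g q M Xs Z) gs Zs" "vcomputes f q M Zs Y"
    by (auto simp: list_all2_map1)
  have gs: "supp q M (Zs ! i)"
    "digit q M t = 1 \<Longrightarrow> computes (gs ! i) (map (\<lambda>X. digit q X t) Xs) (digit q (Zs ! i) t)"
    if "i < length gs" for i t
    using Comp.IH(2)[OF nth_mem[OF that], of M Xs "Zs ! i"] Comp.prems(2,3)
      list_all2_nthD[OF Zs(1) that] by auto
  have len: "length gs = length Zs" using Zs(1) by (rule list_all2_lengthD)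
  then have "\<forall>Z \<in> set Zs. supp q M Z"
    using gs by (auto simp: in_set_conv_nth)
  from Comp.IH(1)[OF Zs(2) Comp.prems(2) this]
  have f: "supp q M Y"
    "digit q M t = 1 \<Longrightarrow> computes f (map (\<lambda>X. digit q X t) Zs) (digit q Y t)" for t
    by auto
  show ?case
  proof (intro conjI allI impI f(1))
    fix t assume t: "digit q M t = 1"
    show "computes (Comp f gs) (map (\<lambda>X. digit q X t) Xs) (digit q Y t)"
      by (rule computes_Comp[OF _ f(2)[OF t]]) (use gs t len in \<open>auto simp: list_all2_conv_all_nth\<close>)
  qed
next
  case (Prim f g)
  show ?case
  proof (cases Xs)
    case Nil
    then show ?thesis using Prim.prems(1) by (simp add: supp_def submask_0)
  next
    case Xs: (Cons X0 Xs')
    from Prim.prems(1)[unfolded Xs vcomputes.simps list.sel if_not_P[OF list.discI[OF refl]]] obtain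
        d S E K N P Ps Zs A V W Z Q where
      chain: "chain q (Suc d) M S E" and count: "link q (Suc d) M S E 0 (K + S) K N" and
      P: "link q (Suc d) M S E X0 P P N" and
      Ps: "length Ps = length Xs'" "length Zs = length Xs'" "\<And>i. i < length Xs' \<Longrightarrow> link q (Suc d) M S
          E (Xs' ! i) (Ps ! i) (Ps ! i) (Zs ! i)" and
      f: "vcomputes f q M Xs' A" and g: "vcomputes g q S (K # W # Ps) V" and
      AV: "link q (Suc d) M S E A V W Z" and Q: "link q (Suc d) M S E Y Q Q Z"
      by (elim exE conjE) (rule that, (assumption | simp)+)
    have S: "is_mask q S" using chain by (auto simp: chain_def)
    have "\<forall>X \<in> set (K # W # Ps). supp q S X"
      using count AV Ps by (auto simp: link_def in_set_conv_nth)
    \<comment> \<open>A single use of the hypothesis, at the mask \<open>S\<close>, covers every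
      step of every run.\<close>
    note g = Prim.IH(2)[OF g S this]
    note f = Prim.IH(1)[OF f Prim.prems(2)]
    show ?thesis
    proof (intro conjI allI impI)
      show "supp q M Y" using Q by (simp add: link_def)
      fix t assume t: "digit q M t = 1"
      obtain n where run: "\<forall>j < n. digit q S (t + Suc d * j) = 1 \<and> digit q K (t + Suc d * j) = j"
        "digit q E (t + Suc d * n) = 1"
        "digit q N (t + Suc d * n) = n"
        "\<forall>X P Z. link q (Suc d) M S E X P P Z \<longrightarrow>
          (\<forall>j < n. digit q P (t + Suc d * j) = digit q X t) \<and> digit q Z (t + Suc d * n) = digit q X t"
        "\<forall>A V W Z. link q (Suc d) M S E A V W Z \<longrightarrow>
          (\<exists>a. a 0 = digit q A t \<and> (\<forall>j < n. a j = digit q W (t + Suc d * j) \<and> a (Suc j) = digit q V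
              (t + Suc d * j))
            \<and> a n = digit q Z (t + Suc d * n))"
        by (rule chain_run_basic[OF Prim.prems(2) chain zero_less_Suc t count]) (rule that; assumption)
      note const = run(4)[rule_format]
      have n: "\<And>j. j < n \<Longrightarrow> digit q S (t + Suc d * j) = 1" "\<And>j. j < n \<Longrightarrow> digit q K (t + Suc d * j) = j"
        "digit q N (t + Suc d * n) = n" using run by simp_all
      let ?xs = "map (\<lambda>X. digit q X t) Xs'"
      have ps: "map (\<lambda>X. digit q X (t + Suc d * j)) Ps = ?xs" if "j < n" for j
        using const[OF Ps(3)] Ps(1) that by (intro nth_equalityI) auto
      obtain a where a: "a 0 = digit q A t" "a n = digit q Z (t + Suc d * n)"
        "\<And>j. j < n \<Longrightarrow> a j = digit q W (t + Suc d * j) \<and> a (Suc j) = digit q V (t + Suc d * j)"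
        using run(5)[rule_format, OF AV] by blast
      have "j \<le> n \<Longrightarrow> computes (Prim f g) (j # ?xs) (a j)" for j
      proof (induction j)
        case 0
        show ?case using f t a(1) Prim.prems(3) by (auto simp: Xs intro!: computes_Prim_0)
      next
        case (Suc j)
        then have "computes g (j # a j # ?xs) (a (Suc j))"
          using g n(1,2)[of j] a(3)[of j] ps[of j] by fastforce
        then show ?case
          using Suc by (intro computes_Prim_Suc) auto
      qed
      from this[of n] have "computes (Prim f g) (n # ?xs) (a n)" by simp
      moreover have "n = digit q X0 t" using const[OF P] n(3) by simp
      moreover have "a n = digit q Y t" using const[OF Q] a(2) by simp
      ultimately show "computes (Prim f g) (map (\<lambda>X. digit q X t) Xs) (digit q Y t)"
        by (simp add: Xs)
    qed
  qed
next
  case (Mu f)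
  from Mu.prems(1)[unfolded vcomputes.simps] obtain d S E K N P Ps Zs V where
    chain: "chain q (Suc d) M S E" and count: "link q (Suc d) M S E 0 (K + S) K N" and
    P: "link q (Suc d) M S E Y P P N" and
    Ps: "length Ps = length Xs" "length Zs = length Xs"
      "\<And>i. i < length Xs \<Longrightarrow> link q (Suc d) M S E (Xs ! i) (Ps ! i) (Ps ! i) (Zs ! i)" and
    V: "supp q S V" "supp q S (V + S)" and
    f: "vcomputes f q (S + E) ((K + N) # map2 (+) Ps Zs) (V + S)"
    by (elim exE conjE) (rule that, (assumption | simp)+)
  have S: "is_mask q S" and SE: "is_mask q (S + E)" using chain by (auto simp: chain_def)
  note union = supp_union[OF Mu.prems(2) chain]
  have "\<forall>X \<in> set ((K + N) # map2 (+) Ps Zs). supp q (S + E) X"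
    using count Ps union by (auto simp: link_def in_set_zip)
  note f = Mu.IH[OF f SE this]
  \<comment> \<open>The search condition: adding \<open>S\<close> makes the results positive before
    the end of a run, and their support in \<open>S\<close> makes them zero at the end.\<close>
  have VS: "digit q (V + S) i = digit q V i + digit q S i" for i
    using supp_digit_less[OF S V(1)] is_mask_less_half[OF S] by (intro digit_add_half) auto
  show ?case
  proof (intro conjI allI impI)
    show "supp q M Y" using P by (simp add: link_def)
    fix t assume t: "digit q M t = 1"
    obtain n where run: "\<forall>j < n. digit q S (t + Suc d * j) = 1 \<and> digit q K (t + Suc d * j) = j"
      "digit q E (t + Suc d * n) = 1"
      "digit q N (t + Suc d * n) = n"
      "\<forall>X P Z. link q (Suc d) M S E X P P Z \<longrightarrow>
        (\<forall>j < n. digit q P (t + Suc d * j) = digit q X t) \<and> digit q Z (t + Suc d * n) = digit q X t"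
      "\<forall>A V W Z. link q (Suc d) M S E A V W Z \<longrightarrow>
        (\<exists>a. a 0 = digit q A t \<and> (\<forall>j < n. a j = digit q W (t + Suc d * j) \<and> a (Suc j) = digit q V (t
            + Suc d * j))
          \<and> a n = digit q Z (t + Suc d * n))"
      by (rule chain_run_basic[OF Mu.prems(2) chain zero_less_Suc t count]) (rule that; assumption)
    note const = run(4)[rule_format]
    have n: "\<And>j. j < n \<Longrightarrow> digit q S (t + Suc d * j) = 1" "\<And>j. j < n \<Longrightarrow> digit q K (t + Suc d * j) = j"
      "digit q E (t + Suc d * n) = 1" "digit q N (t + Suc d * n) = n" using run by simp_all
    let ?xs = "map (\<lambda>X. digit q X t) Xs"
    have E0: "digit q E (t + Suc d * j) = 0" if "j < n" for j
      using chain_digits(2)[OF Mu.prems(2) chain, of "t + Suc d * j"] n(1)[OF that] by simp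
    have S0: "digit q S (t + Suc d * n) = 0"
      using chain_digits(2)[OF Mu.prems(2) chain, of "t + Suc d * n"] n(3) by simp
    have E: "is_mask q E" using chain by (auto simp: chain_def)
    have args: "map (\<lambda>X. digit q X (t + Suc d * j)) ((K + N) # map2 (+) Ps Zs) = j # ?xs"
      if "j \<le> n" for j
    proof (intro nth_equalityI)
      fix i assume "i < length (map (\<lambda>X. digit q X (t + Suc d * j)) ((K + N) # map2 (+) Ps Zs))"
      then have i: "i < Suc (length Xs)" using Ps by simp
      have sum: "digit q (A + Z) (t + Suc d * j) = (if j < n then digit q A (t + Suc d * j) else
          digit q Z (t + Suc d * n))"
        if "supp q S A" "supp q E Z" for A Z
        using union(2)[OF that, of "t + Suc d * j"] supp_digit_0[OF S that(1)] supp_digit_0[OF E that(2)]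
          E0[of j] S0 \<open>j \<le> n\<close> by auto
      show "map (\<lambda>X. digit q X (t + Suc d * j)) ((K + N) # map2 (+) Ps Zs) ! i = (j # ?xs) ! i"
      proof (cases i)
        case 0
        have "supp q S K" "supp q E N" using count by (auto simp: link_def)
        from sum[OF this] show ?thesis using n 0 that by auto
      next
        case (Suc k)
        then have k: "k < length Xs" using i by simp
        then have "supp q S (Ps ! k)" "supp q E (Zs ! k)" using Ps(3) by (auto simp: link_def)
        from sum[OF this] show ?thesis using const[OF Ps(3)[OF k]] Suc k Ps(1,2) that by auto
      qed
    qed (use Ps in simp)
    have comp: "computes f (j # ?xs) (digit q (V + S) (t + Suc d * j))" if "j \<le> n" for j
    proof -
      have "digit q (S + E) (t + Suc d * j) = 1"
        using that n(1)[of j] n(3) E0[of j] S0 chain_digits(3)[OF Mu.prems(2) chain, of "t + Suc d * j"]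
        by (cases "j = n") auto
      with f have "computes f (map (\<lambda>X. digit q X (t + Suc d * j)) ((K + N) # map2 (+) Ps Zs))
          (digit q (V + S) (t + Suc d * j))" by blast
      then show ?thesis unfolding args[OF that] .
    qed
    have "computes (Mu f) ?xs n"
    proof (rule computes_Mu)
      show "computes f (n # ?xs) 0"
        using comp[of n] supp_digit_0[OF S V(2) S0] by simp
      show "\<exists>v>0. computes f (k # ?xs) v" if "k < n" for k
        using comp[of k] that n(1)[of k] VS by (intro exI[of _ "digit q (V + S) (t + Suc d * k)"]) auto
    qed
    moreover have "n = digit q Y t" using const[OF P] n(4) by simp
    ultimately show "computes (Mu f) ?xs (digit q Y t)" by simp
  qed
qed

section \<open>Digitwise computation is exponential Diophantine\<close>

lemma exp_dioph_fun_half: "exp_dioph_fun q \<Longrightarrow> exp_dioph_fun (\<lambda>\<rho>. half (q \<rho>))"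
  unfolding half_def by (intro exp_dioph_intros)

lemma exp_dioph_fun_base: "exp_dioph_fun q \<Longrightarrow> exp_dioph_fun (\<lambda>\<rho>. base (q \<rho>))"
  unfolding base_def by (intro exp_dioph_intros)

text \<open>Here it matters that the base is a power of two: a power of it with variable exponent is
  again a power of two.\<close>

lemma exp_dioph_fun_base_power: "exp_dioph_fun q \<Longrightarrow> exp_dioph_fun d \<Longrightarrow> exp_dioph_fun (\<lambda>\<rho>. base (q \<rho>) ^ d \<rho>)"
  unfolding base_def power_mult[symmetric] by (intro exp_dioph_intros)

lemma exp_dioph_is_mask:
  assumes "exp_dioph_fun q" "exp_dioph_fun M"
  shows "exp_dioph (\<lambda>\<rho>. is_mask (q \<rho>) (M \<rho>))"
  unfolding is_mask_def
  by (intro exp_dioph_intros exp_dioph_submask exp_dioph_fun_diff exp_dioph_fun_base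
      exp_dioph_fun_base_power assms[THEN exp_dioph_fun_subst])

lemma exp_dioph_supp: "exp_dioph_fun q \<Longrightarrow> exp_dioph_fun M \<Longrightarrow> exp_dioph_fun X \<Longrightarrow> exp_dioph (\<lambda>\<rho>. supp (q
    \<rho>) (M \<rho>) (X \<rho>))"
  unfolding supp_def by (intro exp_dioph_intros exp_dioph_submask exp_dioph_fun_diff exp_dioph_fun_half)

lemma exp_dioph_chain:
  assumes "exp_dioph_fun q" "exp_dioph_fun d" "exp_dioph_fun M" "exp_dioph_fun S" "exp_dioph_fun E"
  shows "exp_dioph (\<lambda>\<rho>. chain (q \<rho>) (d \<rho>) (M \<rho>) (S \<rho>) (E \<rho>))"
  unfolding chain_def by (intro exp_dioph_intros exp_dioph_is_mask exp_dioph_fun_base_power assms)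

lemma exp_dioph_link:
  assumes "exp_dioph_fun q" "exp_dioph_fun d" "exp_dioph_fun M" "exp_dioph_fun S" "exp_dioph_fun E"
      "exp_dioph_fun A" "exp_dioph_fun V" "exp_dioph_fun W" "exp_dioph_fun Z"
  shows "exp_dioph (\<lambda>\<rho>. link (q \<rho>) (d \<rho>) (M \<rho>) (S \<rho>) (E \<rho>) (A \<rho>) (V \<rho>) (W \<rho>) (Z \<rho>))"
  unfolding link_def by (intro exp_dioph_intros exp_dioph_supp exp_dioph_fun_base_power assms)

lemma exp_dioph_list_length: "exp_dioph_list k l \<Longrightarrow> length (l \<rho>) = k"
  by (simp add: exp_dioph_list_def)

lemma exp_dioph_list_map2_add: "exp_dioph_list k l \<Longrightarrow> exp_dioph_list k l' \<Longrightarrow> exp_dioph_list k (\<lambda>\<rho>.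
    map2 (+) (l \<rho>) (l' \<rho>))"
  by (auto simp: exp_dioph_list_def intro: exp_dioph_fun_add)

text \<open>The arity \<open>k\<close> is the same for all valuations. Arity tests are therefore
  decided outside the predicate, and quantifiers over tuples and over their indices have a fixed
  finite size.\<close>

lemma exp_dioph_vcomputes:
  "exp_dioph_fun q \<Longrightarrow> exp_dioph_fun M \<Longrightarrow> exp_dioph_list k Xs \<Longrightarrow> exp_dioph_fun Y \<Longrightarrow> exp_dioph (\<lambda>\<rho>.
      vcomputes f (q \<rho>) (M \<rho>) (Xs \<rho>) (Y \<rho>))"
proof (induction f arbitrary: q M k Xs Y)
  case Zero
  then show ?case unfolding vcomputes.simps by (intro exp_dioph_intros)
next
  case Succ
  show ?case
  proof (cases "k = 1")
    case True
    then have "exp_dioph_fun (\<lambda>\<rho>. hd (Xs \<rho>))" using Succ.prems(3) exp_dioph_list_hd[of 0 Xs] by simp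
    then show ?thesis unfolding vcomputes.simps exp_dioph_list_length[OF Succ.prems(3)] if_P[OF True]
      by (intro exp_dioph_intros exp_dioph_supp Succ.prems)
  next
    case False
    then show ?thesis using Succ.prems unfolding vcomputes.simps exp_dioph_list_length[OF Succ.prems(3)]
      by (simp add: exp_dioph_conj exp_dioph_eq exp_dioph_fun_const)
  qed
next
  case (Proj i)
  show ?case
  proof (cases "i < k")
    case True
    then show ?thesis unfolding vcomputes.simps exp_dioph_list_length[OF Proj.prems(3)] if_P[OF True]
      by (intro exp_dioph_intros exp_dioph_list_nth[OF Proj.prems(3)] Proj.prems)
  next
    case False
    then show ?thesis using Proj.prems unfolding vcomputes.simps exp_dioph_list_length[OF Proj.prems(3)]
      by (simp add: exp_dioph_conj exp_dioph_eq exp_dioph_fun_const)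
  qed
next
  case (Comp f gs)
  have eq: "vcomputes (Comp f gs) q M Xs Y \<longleftrightarrow> (\<exists>Zs. length Zs = length gs \<and>
      ((\<forall>i < length gs. vcomputes (gs ! i) q M Xs (Zs ! i)) \<and> vcomputes f q M Zs Y))" for q M Xs Y
    by (simp add: list_all2_conv_all_nth list_all2_map1) metis
  show ?case
    unfolding eq
    by (intro exp_dioph_ex_list exp_dioph_conj exp_dioph_all_less Comp.IH(2)[OF nth_mem _ _
        exp_dioph_list_subst[OF Comp.prems(3)]]
        Comp.IH(1)[OF _ _ exp_dioph_list_vars] exp_dioph_list_nth[OF exp_dioph_list_vars]
            Comp.prems(1,2,4)[THEN exp_dioph_fun_subst])
next
  case (Prim f g)
  show ?case
  proof (cases k)
    case 0
    then have "Xs \<rho> = []" for \<rho> using exp_dioph_list_length[OF Prim.prems(3)] by simp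
    then show ?thesis using Prim.prems by (simp add: exp_dioph_conj exp_dioph_eq exp_dioph_fun_const)
  next
    case (Suc k')
    then have X: "exp_dioph_fun (\<lambda>\<rho>. hd (Xs \<rho>))" "exp_dioph_list k' (\<lambda>\<rho>. tl (Xs \<rho>))" "Xs \<rho> \<noteq> []"
        "length (tl (Xs \<rho>)) = k'" for \<rho>
      using Prim.prems(3) exp_dioph_list_hd exp_dioph_list_tl exp_dioph_list_length[OF
          Prim.prems(3), of \<rho>] by auto
    note subst = Prim.prems(1,2,4)[THEN exp_dioph_fun_subst] X(1)[THEN exp_dioph_fun_subst]
        X(2)[THEN exp_dioph_list_subst]
    show ?thesis
      unfolding vcomputes.simps X(4) if_not_P[OF X(3)]
      by (intro exp_dioph_const exp_dioph_conj exp_dioph_ex exp_dioph_ex_list exp_dioph_all_less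
          Prim.IH(1)[OF _ _ X(2)[THEN exp_dioph_list_subst]]
          Prim.IH(2)[OF _ _ exp_dioph_list_Cons[OF exp_dioph_fun_var exp_dioph_list_Cons[OF
              exp_dioph_fun_var exp_dioph_list_vars]]] exp_dioph_chain exp_dioph_link
              exp_dioph_fun_var exp_dioph_fun_Suc exp_dioph_fun_const exp_dioph_fun_add
          exp_dioph_list_nth[OF exp_dioph_list_vars] exp_dioph_list_nth[OF X(2)[THEN
              exp_dioph_list_subst]] subst exp_dioph_list_Cons exp_dioph_list_vars)
  qed
next
  case (Mu f)
  note subst = Mu.prems(1,2,4)[THEN exp_dioph_fun_subst] Mu.prems(3)[THEN exp_dioph_list_subst]
  show ?case
    unfolding vcomputes.simps exp_dioph_list_length[OF Mu.prems(3)]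
    by (intro exp_dioph_const exp_dioph_conj exp_dioph_ex exp_dioph_ex_list exp_dioph_all_less
        Mu.IH[OF _ _ exp_dioph_list_Cons[OF exp_dioph_fun_add[OF exp_dioph_fun_var
            exp_dioph_fun_var] exp_dioph_list_map2_add[OF exp_dioph_list_vars exp_dioph_list_vars]]]
            exp_dioph_chain exp_dioph_link exp_dioph_supp exp_dioph_fun_var exp_dioph_fun_Suc
            exp_dioph_fun_const exp_dioph_fun_add
        exp_dioph_list_nth[OF exp_dioph_list_vars] exp_dioph_list_nth[OF Mu.prems(3)[THEN
            exp_dioph_list_subst]] subst exp_dioph_list_Cons exp_dioph_list_vars exp_dioph_list_map2_add)
qed

subsection \<open>Completeness\<close>

definition spaced :: "nat \<Rightarrow> nat set \<Rightarrow> bool" where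
  "spaced d S \<longleftrightarrow> (\<forall>p \<in> S. \<forall>p' \<in> S. p < p' \<longrightarrow> p + d \<le> p')"

abbreviation pk :: "nat \<Rightarrow> nat set \<Rightarrow> (nat \<Rightarrow> nat) \<Rightarrow> nat" where
  "pk q \<equiv> pack (base q)"

abbreviation ones :: "nat \<Rightarrow> nat set \<Rightarrow> nat" where
  "ones q S \<equiv> pk q S (\<lambda>_. Suc 0)"

text \<open>All positions of the runs but the last ones, hence the mask \<open>S\<close> of
  \<open>chain\<close>. The set \<open>S\<close> here holds the starting positions, which are the
  mask \<open>M\<close> there.\<close>

definition run_start :: "nat \<Rightarrow> nat set \<Rightarrow> (nat \<Rightarrow> nat) \<Rightarrow> nat set" where
  "run_start d S n = (\<lambda>(p, j). p + d * j) ` Sigma S (\<lambda>p. {..<n p})"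

definition run_end :: "nat \<Rightarrow> nat set \<Rightarrow> (nat \<Rightarrow> nat) \<Rightarrow> nat set" where
  "run_end d S n = (\<lambda>p. p + d * n p) ` S"

text \<open>Turns a family indexed by run and step into one indexed by digit position. It relies on
  distinct positions for distinct pairs, which the spacing in \<open>runs\<close> provides.\<close>

definition spread :: "nat \<Rightarrow> nat set \<Rightarrow> (nat \<Rightarrow> nat) \<Rightarrow> (nat \<Rightarrow> nat \<Rightarrow> 'a) \<Rightarrow> nat \<Rightarrow> 'a" where
  "spread d S n F i = case_prod F (inv_into (Sigma S (\<lambda>p. {..n p})) (\<lambda>(p, j). p + d * j) i)"

lemma spaced_mono: "spaced d S \<Longrightarrow> d' \<le> d \<Longrightarrow> spaced d' S"
  by (fastforce simp: spaced_def)

lemma spread_comp: "h (spread d S n F i) = spread d S n (\<lambda>p j. h (F p j)) i"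
  by (simp add: spread_def split: prod.split)

lemma digit_pk:
  assumes "finite S" "\<And>i. i \<in> S \<Longrightarrow> v i < half q"
  shows "digit q (pk q S v) j = (if j \<in> S then v j else 0)"
  using assms(2) by (intro dig_pack assms(1)) (fastforce simp: base_eq)

lemma digit_ones: "finite S \<Longrightarrow> digit q (ones q S) j = (if j \<in> S then 1 else 0)"
  using half_ge(1)[of q] digit_pk[of S "\<lambda>_. Suc 0" q j] by simp

lemma is_mask_ones: "finite S \<Longrightarrow> is_mask q (ones q S)"
  by (simp add: is_mask_iff digit_ones)

lemma supp_pk: "finite S \<Longrightarrow> (\<And>i. i \<in> S \<Longrightarrow> v i < half q) \<Longrightarrow> supp q (ones q S) (pk q S v)"
  using half_ge(1)[of q] by (subst supp_iff[OF is_mask_ones]) (auto simp: digit_pk digit_ones)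

text \<open>A run occupies at most \<open>B + 1\<close> positions with step \<open>d\<close>, so
  starts at distance \<open>d * (B + 1)\<close> keep the runs disjoint and even leave the gap
  \<open>d\<close> between them.\<close>

locale runs =
  fixes d B :: nat and S :: "nat set" and n :: "nat \<Rightarrow> nat"
  assumes d: "d > 0" and finite_S: "finite S" and spaced_S: "spaced (d * (B + 1)) S"
    and n_le: "\<And>p. p \<in> S \<Longrightarrow> n p \<le> B"
begin

lemma distinct_start:
  assumes "p \<in> S" "p' \<in> S" "j \<le> n p" "j' \<le> n p'" "p < p'"
  shows "p + d * j + d \<le> p' + d * j'"
proof -
  have "d * j + d \<le> d * (B + 1)"
    using n_le[OF assms(1)] assms(3) by simp
  moreover have "p + d * (B + 1) \<le> p'"
    using spaced_S assms(1,2,5) by (simp add: spaced_def)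
  ultimately show ?thesis by linarith
qed

lemma inj_position: "inj_on (\<lambda>(p, j). p + d * j) (Sigma S (\<lambda>p. {..n p}))"
proof (rule inj_onI)
  fix x y
  assume xy: "x \<in> Sigma S (\<lambda>p. {..n p})" "y \<in> Sigma S (\<lambda>p. {..n p})"
    "(case x of (p, j) \<Rightarrow> p + d * j) = (case y of (p, j) \<Rightarrow> p + d * j)"
  obtain p j p' j' where x: "x = (p, j)" and y: "y = (p', j')" by (cases x, cases y)
  have *: "p \<in> S" "p' \<in> S" "j \<in> {..n p}" "j' \<in> {..n p'}" "p + d * j = p' + d * j'"
    using xy by (simp_all add: x y)
  have "p = p'"
  proof (cases p p' rule: linorder_cases)
    case less
    then show "p = p'" using distinct_start[of p p' j j'] * d by auto
  next
    case greater
    then show "p = p'" using distinct_start[of p' p j' j] * d by auto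
  qed auto
  then show "x = y" using * d by (simp add: x y)
qed

lemma spread_position: "p \<in> S \<Longrightarrow> j \<le> n p \<Longrightarrow> spread d S n F (p + d * j) = F p j"
  using inv_into_f_f[OF inj_position, of "(p, j)"] by (simp add: spread_def)

abbreviation "T \<equiv> run_start d S n"
abbreviation "E \<equiv> run_end d S n"
abbreviation "sp \<equiv> spread d S n"

lemma finite_T: "finite T" and finite_E: "finite E"
  by (auto simp: run_start_def run_end_def finite_S)

lemma T_cases: "i \<in> T \<Longrightarrow> (\<And>p j. p \<in> S \<Longrightarrow> j < n p \<Longrightarrow> i = p + d * j \<Longrightarrow> P) \<Longrightarrow> P"
  by (auto simp: run_start_def)

lemma E_cases: "i \<in> E \<Longrightarrow> (\<And>p. p \<in> S \<Longrightarrow> i = p + d * n p \<Longrightarrow> P) \<Longrightarrow> P"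
  by (auto simp: run_end_def)

lemma TE_cases: "i \<in> T \<union> E \<Longrightarrow> (\<And>p j. p \<in> S \<Longrightarrow> j \<le> n p \<Longrightarrow> i = p + d * j \<Longrightarrow> P) \<Longrightarrow> P"
  by (auto simp: run_start_def run_end_def) (blast intro: less_imp_le_nat)

lemma spread_T: "i \<in> T \<Longrightarrow> (\<And>p j. p \<in> S \<Longrightarrow> j < n p \<Longrightarrow> Q (F p j)) \<Longrightarrow> Q (sp F i)"
  by (auto elim!: T_cases simp: spread_position)

lemma T_E_disjoint: "T \<inter> E = {}"
proof -
  have False if "i \<in> T" "i \<in> E" for i
    using spread_position[where F = "\<lambda>p j. j < n p"] that
    by (auto elim!: T_cases E_cases) (metis less_imp_le_nat less_irrefl order_refl)
  then show ?thesis by auto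
qed

text \<open>Makes the induction hypothesis for an inner program applicable: its positions are spaced
  by the step of the runs.\<close>

lemma spaced_TE: "spaced d (T \<union> E)"
  unfolding spaced_def
proof (intro ballI impI)
  fix i i' assume *: "i \<in> T \<union> E" "i' \<in> T \<union> E" "i < i'"
  obtain p j where p: "p \<in> S" "j \<le> n p" "i = p + d * j" using TE_cases[OF *(1)] .
  obtain p' j' where p': "p' \<in> S" "j' \<le> n p'" "i' = p' + d * j'" using TE_cases[OF *(2)] .
  show "i + d \<le> i'"
  proof (cases p p' rule: linorder_cases)
    case less
    then show ?thesis using distinct_start p p' by simp
  next
    case greater
    then show ?thesis using distinct_start[of p' p j' j] p p' *(3) by simp
  next
    case equal
    then have "Suc j \<le> j'" using p p' *(3) d by (simp add: Suc_le_eq)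
    then have "d * Suc j \<le> d * j'" by (rule mult_le_mono2)
    then show ?thesis using p p' equal by simp
  qed
qed

lemma pk_T: "pk q T (sp F) = (\<Sum>p \<in> S. \<Sum>j < n p. F p j * base q ^ (p + d * j))"
proof -
  have "inj_on (\<lambda>(p, j). p + d * j) (Sigma S (\<lambda>p. {..<n p}))"
    by (rule inj_on_subset[OF inj_position]) auto
  then have "pk q T (sp F) = (\<Sum>(p, j) \<in> Sigma S (\<lambda>p. {..<n p}). sp F (p + d * j) * base q ^ (p + d * j))"
    by (simp add: pack_def run_start_def sum.reindex case_prod_unfold)
  also have "\<dots> = (\<Sum>p \<in> S. \<Sum>j < n p. sp F (p + d * j) * base q ^ (p + d * j))"
    by (rule sum.Sigma[symmetric]) (auto simp: finite_S)
  also have "\<dots> = (\<Sum>p \<in> S. \<Sum>j < n p. F p j * base q ^ (p + d * j))"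
    by (intro sum.cong refl) (simp add: spread_position)
  finally show ?thesis .
qed

lemma pk_E: "pk q E (sp F) = (\<Sum>p \<in> S. F p (n p) * base q ^ (p + d * n p))"
proof -
  have "inj_on (\<lambda>p. p + d * n p) S"
    using inj_position by (auto simp: inj_on_def)
  then show ?thesis
    by (simp add: pack_def run_end_def sum.reindex spread_position)
qed

text \<open>Both sides collect the values \<open>F p 0\<close> to \<open>F p (n p)\<close> of every
  run; the left one splits off the first value and the right one the last.\<close>

lemma pk_run: "pk q S (\<lambda>p. F p 0) + base q ^ d * pk q T (sp (\<lambda>p j. F p (Suc j)))
  = pk q T (sp F) + pk q E (sp F)"
proof -
  have "F p 0 * base q ^ p + base q ^ d * (\<Sum>j < n p. F p (Suc j) * base q ^ (p + d * j))
    = (\<Sum>j < n p. F p j * base q ^ (p + d * j)) + F p (n p) * base q ^ (p + d * n p)" for p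
  proof -
    have "base q ^ d * (\<Sum>j < n p. F p (Suc j) * base q ^ (p + d * j))
        = (\<Sum>j < n p. F p (Suc j) * base q ^ (p + d * Suc j))"
      by (simp add: sum_distrib_left power_add mult_ac)
    then show ?thesis
      using sum.lessThan_Suc_shift[of "\<lambda>j. F p j * base q ^ (p + d * j)" "n p"] by simp
  qed
  then show ?thesis
    unfolding pk_T pk_E pack_def[of _ S] sum_distrib_left sum.distrib[symmetric]
    by (intro sum.cong refl) (simp add: sum_distrib_left)
qed

lemma pk_TE: "pk q (T \<union> E) v = pk q T v + pk q E v"
  unfolding pack_def by (rule sum.union_disjoint[OF finite_T finite_E T_E_disjoint])

lemma chain_runs: "chain q d (ones q S) (ones q T) (ones q E)"
proof -
  have "sp (\<lambda>p j. Suc 0) = (\<lambda>_. Suc 0)" by (auto simp: spread_def split: prod.split)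
  then show ?thesis
    using pk_run[of q "\<lambda>p j. Suc 0"] is_mask_ones[of "T \<union> E" q]
    by (simp add: chain_def is_mask_ones finite_T finite_E pk_TE)
qed

lemma link_runs:
  assumes "\<And>p j. p \<in> S \<Longrightarrow> j \<le> n p \<Longrightarrow> F p j < half q"
  shows "link q d (ones q S) (ones q T) (ones q E)
    (pk q S (\<lambda>p. F p 0)) (pk q T (sp (\<lambda>p j. F p (Suc j)))) (pk q T (sp F)) (pk q E (sp F))"
  unfolding link_def pk_run
  by (intro conjI refl supp_pk finite_S finite_T finite_E)
    (auto elim!: T_cases E_cases simp: spread_position Suc_leI assms)

lemma pk_T_Suc: "pk q T (sp (\<lambda>p j. Suc (F p j))) = pk q T (sp F) + ones q T"
proof -
  have "sp (\<lambda>p j. Suc (F p j)) = (\<lambda>i. sp F i + Suc 0)"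
    using spread_comp[of Suc d S n F] by (simp add: fun_eq_iff)
  then show ?thesis by (simp only: pack_add)
qed

end

section \<open>Packing finitely many halting computations\<close>

lemma computes_Prim_prefix:
  "computes (Prim f g) (n # xs) y \<Longrightarrow> j \<le> n \<Longrightarrow> \<exists>r. computes (Prim f g) (j # xs) r"
proof (induction n arbitrary: y)
  case (Suc n)
  from Suc.prems(1) obtain r where "computes (Prim f g) (n # xs) r"
    by (cases rule: computes.cases) auto
  then show ?case using Suc by (cases "j = Suc n") auto
qed auto

text \<open>
  The distance that the positions need is fixed by the finite set \<open>A\<close> of argument tuples alone, before
  the positions are chosen.  The unrolled runs of a recursion can thus be given a step that suffices
  for the inner program.
\<close>

definition packable :: "recf \<Rightarrow> nat \<Rightarrow> nat list set \<Rightarrow> nat \<Rightarrow> bool" where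
  "packable f k A m \<longleftrightarrow> (\<forall>q \<ge> m. \<forall>S xs y. finite S \<and> spaced m S \<and>
    (\<forall>p \<in> S. xs p \<in> A \<and> computes f (xs p) (y p)) \<longrightarrow>
    vcomputes f q (ones q S) (map (\<lambda>l. pk q S (\<lambda>p. xs p ! l)) [0..<k]) (pk q S y))"

definition result :: "recf \<Rightarrow> nat list \<Rightarrow> nat" where
  "result f xs = (THE y. computes f xs y)"

lemma result_eq: "computes f xs y \<Longrightarrow> result f xs = y"
  unfolding result_def using computes_deterministic by (intro the_equality) auto

lemma computes_result: "computes f xs y \<Longrightarrow> computes f xs (result f xs)"
  by (simp add: result_eq)

lemma packable_mono: "packable f k A m \<Longrightarrow> m \<le> m' \<Longrightarrow> packable f k A m'"
  unfolding packable_def using spaced_mono[of m' _ m] by (meson order.trans)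

lemma packableD:
  assumes "packable f k A m" "m \<le> q" "finite S" "spaced m S"
    "\<And>p. p \<in> S \<Longrightarrow> xs p \<in> A" "\<And>p. p \<in> S \<Longrightarrow> computes f (xs p) (y p)"
  shows "vcomputes f q (ones q S) (map (\<lambda>l. pk q S (\<lambda>p. xs p ! l)) [0..<k]) (pk q S y)"
  using assms unfolding packable_def by blast

lemma vcomputes_PrimI:
  assumes "chain q (Suc d) M S E" "link q (Suc d) M S E 0 (K + S) K N"
    "link q (Suc d) M S E X P P N" "length Ps = length Xs" "length Zs = length Xs"
    "\<forall>i < length Xs. link q (Suc d) M S E (Xs ! i) (Ps ! i) (Ps ! i) (Zs ! i)"
    "vcomputes f q M Xs A" "vcomputes g q S (K # W # Ps) V"
    "link q (Suc d) M S E A V W Z" "link q (Suc d) M S E Y Q Q Z"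
  shows "vcomputes (Prim f g) q M (X # Xs) Y"
  unfolding vcomputes.simps list.sel if_not_P[OF list.discI[OF refl]]
  by (intro exI conjI) (rule assms)+

lemma vcomputes_MuI:
  assumes "chain q (Suc d) M S E" "link q (Suc d) M S E 0 (K + S) K N"
    "link q (Suc d) M S E Y P P N" "length Ps = length Xs" "length Zs = length Xs"
    "\<forall>i < length Xs. link q (Suc d) M S E (Xs ! i) (Ps ! i) (Ps ! i) (Zs ! i)"
    "supp q S V" "supp q S (V + S)"
    "vcomputes f q (S + E) ((K + N) # map2 (+) Ps Zs) (V + S)"
  shows "vcomputes (Mu f) q M Xs Y"
  unfolding vcomputes.simps
  by (intro exI conjI) (rule assms)+

lemma finite_nat_less: "finite X \<Longrightarrow> \<exists>B. \<forall>x \<in> X. x < B" for X :: "nat set"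
  using finite_nat_set_iff_bounded by blast

lemma map_upt_Suc_Cons: "map h [0..<Suc k] = h 0 # map (\<lambda>l. h (Suc l)) [0..<k]"
  by (simp add: upt_conv_Cons map_Suc_upt[symmetric] comp_def del: upt_Suc)

lemma packable_exists:
  assumes "finite A" "\<And>xs. xs \<in> A \<Longrightarrow> length xs = k" "\<And>xs. xs \<in> A \<Longrightarrow> \<exists>y. computes f xs y"
  shows "\<exists>m. packable f k A m"
  using assms
proof (induction f arbitrary: k A)
  case Zero
  have "packable Zero k A 0"
    unfolding packable_def
  proof (intro allI impI)
    fix q :: nat and S xs y
    assume *: "finite S \<and> spaced 0 S \<and> (\<forall>p \<in> S. xs p \<in> A \<and> computes Zero (xs p) (y p))"
    have "y p = 0" if "p \<in> S" for p
      using * that computes_deterministic computes_Zero by blast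
    then show "vcomputes Zero q (ones q S) (map (\<lambda>l. pk q S (\<lambda>p. xs p ! l)) [0..<k]) (pk q S y)"
      by (simp add: pack_def)
  qed
  then show ?case ..
next
  case Succ
  have args: "\<exists>x. xs = [x] \<and> y = Suc x" if "computes Succ xs y" for xs y
    using that by (cases rule: computes.cases) auto
  obtain B where B: "\<forall>x \<in> (\<lambda>xs. Suc (hd xs)) ` A. x < B"
    using finite_nat_less Succ.prems(1) by blast
  have "packable Succ k A B"
    unfolding packable_def
  proof (intro allI impI)
    fix q :: nat and S xs y
    assume q: "B \<le> q"
      and *: "finite S \<and> spaced B S \<and> (\<forall>p \<in> S. xs p \<in> A \<and> computes Succ (xs p) (y p))"
    show "vcomputes Succ q (ones q S) (map (\<lambda>l. pk q S (\<lambda>p. xs p ! l)) [0..<k]) (pk q S y)"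
    proof (cases "S = {}")
      case False
      then have k: "k = 1" using * Succ.prems(2) args by fastforce
      have y: "xs p = [xs p ! 0] \<and> y p = xs p ! 0 + Suc 0" if "p \<in> S" for p
        using * that args by fastforce
      have "y p < half q" if "p \<in> S" for p
      proof -
        have "Suc (hd (xs p)) < B" using B * that by blast
        moreover have "y p = Suc (hd (xs p))" using y[OF that] by (metis add_Suc_right add_0_right
            list.sel(1))
        ultimately show ?thesis using q half_ge(2)[of q] by simp
      qed
      then have "supp q (ones q S) (pk q S y)"
        using * by (intro supp_pk) auto
      moreover have "pk q S y = pk q S (\<lambda>p. xs p ! 0) + ones q S"
        unfolding pack_add[symmetric] using y by (intro pack_cong) auto
      ultimately show ?thesis by (simp add: k)
    qed (simp add: pack_def supp_def submask_0)
  qed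
  then show ?case ..
next
  case (Proj i)
  have args: "i < length xs \<and> y = xs ! i" if "computes (Proj i) xs y" for xs y
    using that by (cases rule: computes.cases) auto
  have "packable (Proj i) k A 0"
    unfolding packable_def
  proof (intro allI impI)
    fix q :: nat and S xs y
    assume *: "finite S \<and> spaced 0 S \<and> (\<forall>p \<in> S. xs p \<in> A \<and> computes (Proj i) (xs p) (y p))"
    show "vcomputes (Proj i) q (ones q S) (map (\<lambda>l. pk q S (\<lambda>p. xs p ! l)) [0..<k]) (pk q S y)"
    proof (cases "S = {}")
      case False
      then have "i < k" using * Proj.prems(2) args by fastforce
      moreover have "pk q S y = pk q S (\<lambda>p. xs p ! i)"
        using * args by (intro pack_cong) blast
      ultimately show ?thesis by simp
    qed (simp add: pack_def)
  qed
  then show ?case ..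
next
  case (Comp f gs)
  have args: "\<exists>zs. list_all2 (\<lambda>g z. computes g xs z) gs zs \<and> computes f zs y"
    if "computes (Comp f gs) xs y" for xs y
    using that by (cases rule: computes.cases) auto
  define zs where "zs xs = map (\<lambda>g. result g xs) gs" for xs
  have zs: "(\<forall>g \<in> set gs. computes g xs (result g xs)) \<and> computes f (zs xs) y"
    if comp: "computes (Comp f gs) xs y" for xs y
  proof -
    obtain us where us: "list_all2 (\<lambda>g z. computes g xs z) gs us" "computes f us y"
      using args[OF comp] by blast
    have "us = zs xs"
      using us(1) by (auto simp: zs_def list_all2_conv_all_nth result_eq intro!: nth_equalityI)
    moreover have "computes g xs (result g xs)" if "g \<in> set gs" for g
      using us(1) that by (auto simp: list_all2_conv_all_nth in_set_conv_nth intro: computes_result)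
    ultimately show ?thesis using us(2) by simp
  qed
  have "\<forall>g \<in> set gs. \<exists>m. packable g k A m"
    using Comp.IH(2)[OF _ Comp.prems(1,2)] Comp.prems(3) zs by blast
  then obtain mg where mg: "\<And>g. g \<in> set gs \<Longrightarrow> packable g k A (mg g)"
    by metis
  have "\<exists>m. packable f (length gs) (zs ` A) m"
  proof (rule Comp.IH(1))
    show "finite (zs ` A)" using Comp.prems(1) by simp
    show "length us = length gs" if "us \<in> zs ` A" for us using that by (auto simp: zs_def)
    show "\<exists>y. computes f us y" if "us \<in> zs ` A" for us using that Comp.prems(3) zs by blast
  qed
  then obtain mf where mf: "packable f (length gs) (zs ` A) mf" ..
  define m where "m = mf + (\<Sum>g \<in> set gs. mg g)"
  have m: "mf \<le> m" "\<And>g. g \<in> set gs \<Longrightarrow> mg g \<le> m"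
    by (auto simp: m_def intro: trans_le_add2 member_le_sum)
  have "packable (Comp f gs) k A m"
    unfolding packable_def
  proof (intro allI impI)
    fix q :: nat and S xs y
    assume q: "m \<le> q"
      and *: "finite S \<and> spaced m S \<and> (\<forall>p \<in> S. xs p \<in> A \<and> computes (Comp f gs) (xs p) (y p))"
    let ?Xs = "map (\<lambda>l. pk q S (\<lambda>p. xs p ! l)) [0..<k]"
    let ?Zs = "map (\<lambda>l. pk q S (\<lambda>p. zs (xs p) ! l)) [0..<length gs]"
    have "vcomputes f q (ones q S) ?Zs (pk q S y)"
      by (rule packableD[OF packable_mono[OF mf m(1)] q]) (use * zs in auto)
    moreover have "vcomputes (gs ! i) q (ones q S) ?Xs (?Zs ! i)" if "i < length gs" for i
    proof -
      have g: "gs ! i \<in> set gs" using that by simp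
      have "?Zs ! i = pk q S (\<lambda>p. result (gs ! i) (xs p))"
        using that by (simp add: zs_def)
      moreover have "vcomputes (gs ! i) q (ones q S) ?Xs (pk q S (\<lambda>p. result (gs ! i) (xs p)))"
        by (rule packableD[OF packable_mono[OF mg[OF g] m(2)[OF g]] q]) (use * zs g in auto)
      ultimately show ?thesis by simp
    qed
    ultimately show "vcomputes (Comp f gs) q (ones q S) ?Xs (pk q S y)"
      unfolding vcomputes.simps
      by (intro exI[of _ ?Zs] conjI) (auto simp: list_all2_conv_all_nth)
  qed
  then show ?case ..
next
  case (Prim f g)
  have nonempty: "xs \<noteq> []" if "computes (Prim f g) xs y" for xs y
    using that by (cases rule: computes.cases) auto
  show ?case
  proof (cases k)
    case 0
    then have "A = {}" using Prim.prems nonempty by fastforce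
    then have "packable (Prim f g) k A 0"
      by (auto simp: packable_def 0 pack_def)
    then show ?thesis ..
  next
    case k: (Suc k')
    define r where "r xs j = result (Prim f g) (j # tl xs)" for xs j
    have cons: "xs = hd xs # tl xs" if "xs \<in> A" for xs
      using Prim.prems(2)[OF that] k by (cases xs) auto
    have r: "computes (Prim f g) (j # tl xs) (r xs j)" if "xs \<in> A" "j \<le> hd xs" for xs j
      using computes_Prim_prefix[of f g "hd xs" "tl xs" _ j] Prim.prems(3)[OF that(1)] cons[OF
          that(1)] that(2)
      unfolding r_def by (metis computes_result)
    have r_0: "computes f (tl xs) (r xs 0)" if "xs \<in> A" for xs
      using r[OF that, of 0] by (auto elim: computes.cases)
    have r_Suc: "computes g (j # r xs j # tl xs) (r xs (Suc j))" if "xs \<in> A" "j < hd xs" for xs j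
    proof -
      have "computes (Prim f g) (Suc j # tl xs) (r xs (Suc j))" using r that by simp
      then obtain v where "computes (Prim f g) (j # tl xs) v" "computes g (j # v # tl xs) (r xs (Suc j))"
        by (cases rule: computes.cases) auto
      then show ?thesis using result_eq r_def by metis
    qed
    have "\<exists>m. packable f k' (tl ` A) m"
      using r_0 Prim.prems by (intro Prim.IH(1)) (auto simp: k)
    then obtain mf where mf: "packable f k' (tl ` A) mf" ..
    \<comment> \<open>All calls of the step program, over all inputs in \<open>A\<close>: finitely
      many, so one distance serves them all.\<close>
    define Ag where "Ag = (\<lambda>(xs, j). j # r xs j # tl xs) ` Sigma A (\<lambda>xs. {..<hd xs})"
    have "\<exists>m. packable g (Suc (Suc k')) Ag m"
      using r_Suc Prim.prems by (intro Prim.IH(2)) (auto simp: k Ag_def)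
    then obtain mg where mg: "packable g (Suc (Suc k')) Ag mg" ..
    have "finite (\<Union>xs \<in> A. set xs \<union> r xs ` {..hd xs})" using Prim.prems(1) by simp
    from finite_nat_less[OF this] obtain B
      where "\<forall>x \<in> (\<Union>xs \<in> A. set xs \<union> r xs ` {..hd xs}). x < B" ..
    then have B: "x \<in> set xs \<Longrightarrow> x < B" "j \<le> hd xs \<Longrightarrow> r xs j < B" if "xs \<in> A" for xs x j
      using that by auto
    \<comment> \<open>\<open>mf\<close> serves the base program at the original positions,
      \<open>Suc mg * (B + 1)\<close> makes room for runs with the positive step
      \<open>Suc mg\<close>, and \<open>B\<close> keeps all stored values below
      \<open>half q\<close>.\<close>
    define m where "m = mf + Suc mg * (B + 1) + B"
    have "packable (Prim f g) k A m"
      unfolding packable_def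
    proof (intro allI impI)
      fix q :: nat and S xs y
      assume q: "m \<le> q"
        and *: "finite S \<and> spaced m S \<and> (\<forall>p \<in> S. xs p \<in> A \<and> computes (Prim f g) (xs p) (y p))"
      then have xs: "\<And>p. p \<in> S \<Longrightarrow> xs p \<in> A" by blast
      have n_less: "hd (xs p) < B" if "p \<in> S" for p
        using B(1)[OF xs[OF that], of "hd (xs p)"] cons[OF xs[OF that]] by (metis list.set_intros(1))
      have tl_less: "tl (xs p) ! l < B" if "p \<in> S" "l < k'" for p l
      proof -
        have "tl (xs p) ! l \<in> set (tl (xs p))"
          using Prim.prems(2)[OF xs[OF that(1)]] that(2) by (simp add: k)
        then show ?thesis
          using B(1)[OF xs[OF that(1)]] cons[OF xs[OF that(1)]] by (metis list.set_intros(2))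
      qed
      have y: "y p = r (xs p) (hd (xs p))" if "p \<in> S" for p
        using * that cons[OF xs[OF that]] result_eq unfolding r_def by metis
      interpret runs "Suc mg" B S "\<lambda>p. hd (xs p)"
      proof
        show "spaced (Suc mg * (B + 1)) S"
          using * spaced_mono[of m S "Suc mg * (B + 1)"] by (simp add: m_def)
        show "hd (xs p) \<le> B" if "p \<in> S" for p using n_less[OF that] by simp
      qed (use * in auto)
      have half: "x < B \<Longrightarrow> x < half q" for x
        using q half_ge(2)[of q] by (simp add: m_def)
      let ?Xs = "map (\<lambda>l. pk q S (\<lambda>p. tl (xs p) ! l)) [0..<k']"
      let ?K = "\<lambda>p j. j" and ?R = "\<lambda>p j. r (xs p) j" and ?P = "\<lambda>l p j. tl (xs p) ! l"
      have Xs: "map (\<lambda>l. pk q S (\<lambda>p. xs p ! l)) [0..<k] = pk q S (\<lambda>p. hd (xs p)) # ?Xs"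
        using cons xs unfolding k map_upt_Suc_Cons
        by (auto intro!: pack_cong) (metis nth_Cons_0, metis nth_Cons_Suc)
      have "vcomputes (Prim f g) q (ones q S) (pk q S (\<lambda>p. hd (xs p)) # ?Xs) (pk q S y)"
      proof (rule vcomputes_PrimI)
        show "chain q (Suc mg) (ones q S) (ones q T) (ones q E)"
          by (rule chain_runs)
        show "link q (Suc mg) (ones q S) (ones q T) (ones q E) 0
            (pk q T (sp ?K) + ones q T) (pk q T (sp ?K)) (pk q E (sp ?K))"
          using link_runs[of ?K q] n_less half pk_T_Suc[of q ?K]
          by (simp add: pack_def[of _ S]) (meson le_less_trans)
        \<comment> \<open>At the end of a run the counter has reached the recursion argument, so the
          counter and the copied argument end in the same number.\<close>
        have "pk q E (sp (\<lambda>p j. hd (xs p))) = pk q E (sp ?K)"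
          by (simp add: pk_E)
        then show "link q (Suc mg) (ones q S) (ones q T) (ones q E) (pk q S (\<lambda>p. hd (xs p)))
            (pk q T (sp (\<lambda>p j. hd (xs p)))) (pk q T (sp (\<lambda>p j. hd (xs p)))) (pk q E (sp ?K))"
          using link_runs[of "\<lambda>p j. hd (xs p)" q] n_less half by simp
        show "\<forall>i < length ?Xs. link q (Suc mg) (ones q S) (ones q T) (ones q E) (?Xs ! i)
            (map (\<lambda>l. pk q T (sp (?P l))) [0..<k'] ! i) (map (\<lambda>l. pk q T (sp (?P l))) [0..<k'] ! i)
            (map (\<lambda>l. pk q E (sp (?P l))) [0..<k'] ! i)"
          using link_runs[of "?P _" q] tl_less half by simp
        show "vcomputes f q (ones q S) ?Xs (pk q S (\<lambda>p. r (xs p) 0))"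
          by (rule packableD[OF mf]) (use q * xs r_0 spaced_mono[of m S mf] in \<open>auto simp: m_def\<close>)
        have "vcomputes g q (ones q T)
          (map (\<lambda>l. pk q T (\<lambda>i. sp (\<lambda>p j. j # r (xs p) j # tl (xs p)) i ! l)) [0..<Suc (Suc k')])
          (pk q T (sp (\<lambda>p j. r (xs p) (Suc j))))"
        proof (rule packableD[OF mg])
          show "mg \<le> q" using q by (simp add: m_def)
          show "finite T" by (rule finite_T)
          show "spaced mg T"
            using spaced_TE spaced_mono[of "Suc mg" "T \<union> E" mg] by (auto simp: spaced_def)
          fix i assume "i \<in> T"
          then obtain p j where i: "p \<in> S" "j < hd (xs p)" "i = p + Suc mg * j" by (rule T_cases)
          have 1: "sp (\<lambda>p j. j # r (xs p) j # tl (xs p)) i = j # r (xs p) j # tl (xs p)"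
            unfolding i(3) using i(1,2) by (intro spread_position) auto
          have 2: "sp (\<lambda>p j. r (xs p) (Suc j)) i = r (xs p) (Suc j)"
            unfolding i(3) using i(1,2) by (intro spread_position) auto
          show "sp (\<lambda>p j. j # r (xs p) j # tl (xs p)) i \<in> Ag"
            unfolding 1 Ag_def using i xs by (auto intro!: image_eqI[of _ _ "(xs p, j)"])
          show "computes g (sp (\<lambda>p j. j # r (xs p) j # tl (xs p)) i) (sp (\<lambda>p j. r (xs p) (Suc j)) i)"
            unfolding 1 2 using i xs r_Suc by auto
        qed
        then show "vcomputes g q (ones q T)
          (pk q T (sp ?K) # pk q T (sp ?R) # map (\<lambda>l. pk q T (sp (?P l))) [0..<k'])
          (pk q T (sp (\<lambda>p j. ?R p (Suc j))))"
          unfolding map_upt_Suc_Cons spread_comp[of "\<lambda>xs. xs ! _"] by simp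
        show "link q (Suc mg) (ones q S) (ones q T) (ones q E) (pk q S (\<lambda>p. r (xs p) 0))
            (pk q T (sp (\<lambda>p j. ?R p (Suc j)))) (pk q T (sp ?R)) (pk q E (sp ?R))"
          by (rule link_runs) (use B(2) half xs in blast)
        have "pk q E (sp (\<lambda>p j. r (xs p) (hd (xs p)))) = pk q E (sp ?R)"
          by (simp add: pk_E)
        moreover have "pk q S y = pk q S (\<lambda>p. r (xs p) (hd (xs p)))"
          by (rule pack_cong) (rule y)
        ultimately show "link q (Suc mg) (ones q S) (ones q T) (ones q E) (pk q S y)
            (pk q T (sp (\<lambda>p j. r (xs p) (hd (xs p))))) (pk q T (sp (\<lambda>p j. r (xs p) (hd (xs p)))))
            (pk q E (sp ?R))"
          using link_runs[of "\<lambda>p j. r (xs p) (hd (xs p))" q] B(2) half xs by simp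
      qed simp_all
      then show "vcomputes (Prim f g) q (ones q S) (map (\<lambda>l. pk q S (\<lambda>p. xs p ! l)) [0..<k]) (pk q S y)"
        unfolding Xs .
    qed
    then show ?thesis ..
  qed
next
  case (Mu f)
  define n where "n xs = result (Mu f) xs" for xs
  define v where "v xs j = result f (j # xs)" for xs j
  have v_end: "computes f (n xs # xs) 0"
    and v_run: "j < n xs \<Longrightarrow> \<exists>u>0. computes f (j # xs) u" if "xs \<in> A" for xs j
  proof -
    have "computes (Mu f) xs (n xs)"
      using Mu.prems(3)[OF that] computes_result unfolding n_def by blast
    then have "computes f (n xs # xs) 0 \<and> (\<forall>j < n xs. \<exists>u>0. computes f (j # xs) u)"
      by (cases rule: computes.cases) auto
    then show "computes f (n xs # xs) 0" "j < n xs \<Longrightarrow> \<exists>u>0. computes f (j # xs) u" by auto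
  qed
  have v: "computes f (j # xs) (v xs j)" if "xs \<in> A" "j \<le> n xs" for xs j
    using v_end[OF that(1)] v_run[OF that(1), of j] that(2) computes_result
    unfolding v_def by (cases "j = n xs") auto
  have v_pos: "v xs j > 0" if "xs \<in> A" "j < n xs" for xs j
    using v_run[OF that] result_eq unfolding v_def by metis
  have v_0: "v xs (n xs) = 0" if "xs \<in> A" for xs
    using v_end[OF that] result_eq unfolding v_def by metis
  \<comment> \<open>Unlike for recursion, the last index \<open>n xs\<close> is included: the search
    also evaluates \<open>f\<close> at the zero that it finds.\<close>
  define Af where "Af = (\<lambda>(xs, j). j # xs) ` Sigma A (\<lambda>xs. {..n xs})"
  have "\<exists>m. packable f (Suc k) Af m"
    using v Mu.prems by (intro Mu.IH) (auto simp: Af_def)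
  then obtain mf where mf: "packable f (Suc k) Af mf" ..
  have "finite (\<Union>xs \<in> A. insert (n xs) (set xs \<union> v xs ` {..n xs}))" using Mu.prems(1) by simp
  from finite_nat_less[OF this] obtain B
    where "\<forall>x \<in> (\<Union>xs \<in> A. insert (n xs) (set xs \<union> v xs ` {..n xs})). x < B" ..
  then have B: "x \<in> set xs \<Longrightarrow> x < B" "n xs < B" "j \<le> n xs \<Longrightarrow> v xs j < B" if "xs \<in> A" for xs x j
    using that by auto
  define m where "m = Suc mf * (B + 1) + B"
  have "packable (Mu f) k A m"
    unfolding packable_def
  proof (intro allI impI)
    fix q :: nat and S xs y
    assume q: "m \<le> q"
      and *: "finite S \<and> spaced m S \<and> (\<forall>p \<in> S. xs p \<in> A \<and> computes (Mu f) (xs p) (y p))"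
    then have xs: "\<And>p. p \<in> S \<Longrightarrow> xs p \<in> A" by blast
    have n_less: "n (xs p) < B" if "p \<in> S" for p
      using B(2) xs[OF that] by blast
    have x_less: "xs p ! l < B" if "p \<in> S" "l < k" for p l
      using B(1)[OF xs[OF that(1)]] Mu.prems(2)[OF xs[OF that(1)]] that(2) by simp
    have y: "y p = n (xs p)" if "p \<in> S" for p
      using * that result_eq unfolding n_def by metis
    interpret runs "Suc mf" B S "\<lambda>p. n (xs p)"
    proof
      show "spaced (Suc mf * (B + 1)) S"
        using * spaced_mono[of m S "Suc mf * (B + 1)"] by (simp add: m_def)
      show "n (xs p) \<le> B" if "p \<in> S" for p using n_less[OF that] by simp
    qed (use * in auto)
    have half: "x < B \<Longrightarrow> x < half q" for x
      using q half_ge(2)[of q] by (simp add: m_def)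
    let ?Xs = "map (\<lambda>l. pk q S (\<lambda>p. xs p ! l)) [0..<k]"
    let ?K = "\<lambda>p j. j" and ?V = "\<lambda>p j. v (xs p) j" and ?P = "\<lambda>l p j. xs p ! l"
    let ?Ps = "map (\<lambda>l. pk q T (sp (?P l))) [0..<k]"
    let ?Zs = "map (\<lambda>l. pk q E (sp (?P l))) [0..<k]"
    \<comment> \<open>The witness for \<open>V\<close> is the value decreased by one; before the end
      of a run values are positive, so adding the mask restores them.\<close>
    have V: "pk q T (sp (\<lambda>p j. ?V p j - 1)) + ones q T = pk q T (sp ?V)"
      unfolding pk_T_Suc[symmetric] unfolding pk_T using v_pos xs by (intro sum.cong refl) auto
    show "vcomputes (Mu f) q (ones q S) ?Xs (pk q S y)"
    proof (rule vcomputes_MuI)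
      show "chain q (Suc mf) (ones q S) (ones q T) (ones q E)"
        by (rule chain_runs)
      show "link q (Suc mf) (ones q S) (ones q T) (ones q E) 0
          (pk q T (sp ?K) + ones q T) (pk q T (sp ?K)) (pk q E (sp ?K))"
        using link_runs[of ?K q] n_less half pk_T_Suc[of q ?K]
        by (simp add: pack_def[of _ S]) (meson le_less_trans)
      have "pk q E (sp (\<lambda>p j. n (xs p))) = pk q E (sp ?K)"
        by (simp add: pk_E)
      moreover have "pk q S y = pk q S (\<lambda>p. n (xs p))"
        by (rule pack_cong) (rule y)
      ultimately show "link q (Suc mf) (ones q S) (ones q T) (ones q E) (pk q S y)
          (pk q T (sp (\<lambda>p j. n (xs p)))) (pk q T (sp (\<lambda>p j. n (xs p)))) (pk q E (sp ?K))"
        using link_runs[of "\<lambda>p j. n (xs p)" q] n_less half by simp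
      show "\<forall>i < length ?Xs. link q (Suc mf) (ones q S) (ones q T) (ones q E) (?Xs ! i)
          (?Ps ! i) (?Ps ! i) (?Zs ! i)"
        using link_runs[of "?P _" q] x_less half by simp
      have V_less: "v (xs p) j < half q" if "p \<in> S" "j < n (xs p)" for p j
        using B(3)[OF xs[OF that(1)], of j] that(2) half by simp
      show "supp q (ones q T) (pk q T (sp (\<lambda>p j. ?V p j - 1)))"

        by (intro supp_pk finite_T, erule spread_T) (auto intro: V_less less_imp_diff_less)
      show "supp q (ones q T) (pk q T (sp (\<lambda>p j. ?V p j - 1)) + ones q T)"
        unfolding V
        by (intro supp_pk finite_T, erule spread_T) (rule V_less)
      have "vcomputes f q (ones q (T \<union> E))
        (map (\<lambda>l. pk q (T \<union> E) (\<lambda>i. sp (\<lambda>p j. j # xs p) i ! l)) [0..<Suc k])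
        (pk q (T \<union> E) (sp ?V))"
      proof (rule packableD[OF mf])
        show "mf \<le> q" using q by (simp add: m_def)
        show "finite (T \<union> E)" using finite_T finite_E by simp
        show "spaced mf (T \<union> E)"
          using spaced_TE spaced_mono[of "Suc mf" "T \<union> E" mf] by auto
        fix i assume "i \<in> T \<union> E"
        then obtain p j where i: "p \<in> S" "j \<le> n (xs p)" "i = p + Suc mf * j" by (rule TE_cases)
        have 1: "sp (\<lambda>p j. j # xs p) i = j # xs p"
          unfolding i(3) using i(1,2) by (intro spread_position) auto
        have 2: "sp ?V i = v (xs p) j"
          unfolding i(3) using i(1,2) by (intro spread_position) auto
        show "sp (\<lambda>p j. j # xs p) i \<in> Af"
          unfolding 1 Af_def using i xs by (auto intro!: image_eqI[of _ _ "(xs p, j)"])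
        show "computes f (sp (\<lambda>p j. j # xs p) i) (sp ?V i)"
          unfolding 1 2 using i xs v by auto
      qed
      moreover have "pk q E (sp ?V) = 0"
        using v_0 xs by (simp add: pk_E)
      moreover have "map (\<lambda>l. pk q T (sp (?P l)) + pk q E (sp (?P l))) [0..<k] = map2 (+) ?Ps ?Zs"
        by (rule nth_equalityI) auto
      ultimately show "vcomputes f q (ones q T + ones q E)
          ((pk q T (sp ?K) + pk q E (sp ?K)) # map2 (+) ?Ps ?Zs)
          (pk q T (sp (\<lambda>p j. ?V p j - 1)) + ones q T)"
        unfolding map_upt_Suc_Cons spread_comp[of "\<lambda>xs. xs ! _"] V pk_TE by simp
    qed simp_all
  qed
  then show ?case ..
qed

text \<open>A single computation uses one position, the digit \<open>0\<close> with mask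
  \<open>1\<close>. The bound on the arguments makes each of them equal to its digit
  \<open>0\<close>.\<close>

lemma computes_iff_vcomputes:
  "computes f xs y \<longleftrightarrow> (\<exists>q. (\<forall>i < length xs. xs ! i < half q) \<and> vcomputes f q 1 xs y)"
proof
  assume comp: "computes f xs y"
  then obtain m where m: "packable f (length xs) {xs} m"
    using packable_exists[of "{xs}" "length xs" f] by auto
  obtain B where B: "\<forall>x \<in> set xs. x < B" using finite_nat_less by blast
  have "vcomputes f (m + B) (ones (m + B) {0}) (map (\<lambda>l. pk (m + B) {0} (\<lambda>p. xs ! l)) [0..<length xs])
    (pk (m + B) {0} (\<lambda>_. y))"
    by (rule packableD[OF m]) (use comp in \<open>auto simp: spaced_def\<close>)
  moreover have "map (\<lambda>l. pk (m + B) {0} (\<lambda>p. xs ! l)) [0..<length xs] = xs"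
    by (rule nth_equalityI) (auto simp: pack_def)
  ultimately have "vcomputes f (m + B) 1 xs y"
    by (simp add: pack_def)
  moreover have "\<forall>i < length xs. xs ! i < half (m + B)"
    using B half_ge(2)[of "m + B"] by (meson le_add2 less_le_trans less_trans nth_mem)
  ultimately show "\<exists>q. (\<forall>i < length xs. xs ! i < half q) \<and> vcomputes f q 1 xs y" by blast
next
  assume "\<exists>q. (\<forall>i < length xs. xs ! i < half q) \<and> vcomputes f q 1 xs y"
  then obtain q where q: "\<forall>i < length xs. xs ! i < half q" "vcomputes f q 1 xs y" by blast
  have mask: "is_mask q 1" "digit q 1 0 = 1"
    using is_mask_ones[of "{0}" q] digit_ones[of "{0}" q 0] by (simp_all add: pack_def)
  have supp: "supp q 1 x \<longleftrightarrow> x < half q" for x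
    using submask_mask[of x "q + 1"] by (simp add: supp_def half_def)
  have digit: "digit q x 0 = x" if "x < half q" for x
    using that by (simp add: dig_0 base_eq)
  have "\<forall>x \<in> set xs. x < half q" using q(1) by (auto simp: in_set_conv_nth)
  then have "y < half q" "computes f (map (\<lambda>x. digit q x 0) xs) (digit q y 0)"
    using vcomputes_sound[OF q(2) mask(1)] mask(2) by (auto simp: supp[simplified])
  moreover have "map (\<lambda>x. digit q x 0) xs = xs"
    using \<open>\<forall>x \<in> set xs. x < half q\<close> digit by (simp add: map_idI)
  ultimately show "computes f xs y"
    using digit by simp
qed

theorem exp_dioph_computes:
  assumes "exp_dioph_list k Xs" "exp_dioph_fun Y"
  shows "exp_dioph (\<lambda>\<rho>. computes f (Xs \<rho>) (Y \<rho>))"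
  unfolding computes_iff_vcomputes exp_dioph_list_length[OF assms(1)]
  by (intro exp_dioph_ex exp_dioph_conj exp_dioph_all_less exp_dioph_less exp_dioph_fun_half
      exp_dioph_fun_var exp_dioph_fun_const exp_dioph_vcomputes[OF _ _ assms(1)[THEN
      exp_dioph_list_subst]]
      exp_dioph_list_nth[OF assms(1)[THEN exp_dioph_list_subst]] assms(2)[THEN exp_dioph_fun_subst])

subsection \<open>Polynomial functions\<close>

abbreviation "keys \<equiv> Poly_Mapping.keys"
abbreviation "lookup \<equiv> Poly_Mapping.lookup"
abbreviation "single \<equiv> Poly_Mapping.single"

definition monom_eval :: "monomial \<Rightarrow> rat vec \<Rightarrow> rat" where
  "monom_eval t x = (\<Prod>i \<in> keys t. (x $ i) ^ lookup t i)"

lemma monom_eval_superset: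
  "finite I \<Longrightarrow> keys t \<subseteq> I \<Longrightarrow> monom_eval t x = (\<Prod>i \<in> I. (x $ i) ^ lookup t i)"
  unfolding monom_eval_def by (rule prod.mono_neutral_left) (auto simp: in_keys_iff)

lemma monom_eval_add: "monom_eval (s + t) x = monom_eval s x * monom_eval t x"
  using monom_eval_superset[of "keys s \<union> keys t" s x] monom_eval_superset[of "keys s \<union> keys t" t x]
    monom_eval_superset[of "keys s \<union> keys t" "s + t" x] Poly_Mapping.keys_add[of s t]
  by (simp add: lookup_add power_add prod.distrib)

lemma mpoly_eval_superset:
  "finite T \<Longrightarrow> keys P \<subseteq> T \<Longrightarrow> mpoly_eval P x = (\<Sum>t \<in> T. lookup P t * monom_eval t x)"
  unfolding mpoly_eval_def monom_eval_def[symmetric]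
  by (rule sum.mono_neutral_left) (auto simp: in_keys_iff)

lemma mpoly_eval_add: "mpoly_eval (P + Q) x = mpoly_eval P x + mpoly_eval Q x"
  using mpoly_eval_superset[of "keys P \<union> keys Q" P x] mpoly_eval_superset[of "keys P \<union> keys Q" Q x]
    mpoly_eval_superset[of "keys P \<union> keys Q" "P + Q" x] Poly_Mapping.keys_add[of P Q]
  by (simp add: lookup_add distrib_right sum.distrib)

lemma mpoly_eval_single: "mpoly_eval (single t c) x = c * monom_eval t x"
  using mpoly_eval_superset[of "{t}" "single t c" x] by simp

lemma mpoly_eval_sum: "mpoly_eval (\<Sum>i \<in> I. P i) x = (\<Sum>i \<in> I. mpoly_eval (P i) x)"
  by (induction I rule: infinite_finite_induct) (simp_all add: mpoly_eval_add mpoly_eval_def[of 0])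

lemma sum_single: "P = (\<Sum>t \<in> keys P. single t (lookup P t))"
proof (rule poly_mapping_eqI)
  fix t
  show "lookup P t = lookup (\<Sum>t \<in> keys P. single t (lookup P t)) t"
    by (simp add: lookup_sum lookup_single when_def sum.delta in_keys_iff)
qed

lemma mpoly_eval_mult: "mpoly_eval (P * Q) x = mpoly_eval P x * mpoly_eval Q x"
proof -
  have "P * Q = (\<Sum>s \<in> keys P. \<Sum>t \<in> keys Q. single (s + t) (lookup P s * lookup Q t))"
    by (subst (1) sum_single[of P], subst (1) sum_single[of Q])
      (simp add: sum_product mult_single)
  then show ?thesis
    by (simp add: mpoly_eval_sum mpoly_eval_single monom_eval_add
        mpoly_eval_def[of P] mpoly_eval_def[of Q] sum_product mult_ac flip: monom_eval_def)
qed

text \<open>Existence of a polynomial is all that the reduction asks of a guard: the code of the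
  polynomials will enter the self-reference as an unanalysed constant.\<close>

definition polynomial_fun :: "nat \<Rightarrow> (rat vec \<Rightarrow> rat) \<Rightarrow> bool" where
  "polynomial_fun N F \<longleftrightarrow> (\<exists>P \<in> polys_in N. \<forall>x. mpoly_eval P x = F x)"

lemma polynomial_fun_const: "polynomial_fun N (\<lambda>x. c)"
  unfolding polynomial_fun_def
  by (rule bexI[of _ "single 0 c"]) (auto simp: mpoly_eval_single monom_eval_def polys_in_def)

lemma polynomial_fun_var: "i < N \<Longrightarrow> polynomial_fun N (\<lambda>x. x $ i)"
  unfolding polynomial_fun_def
  by (rule bexI[of _ "single (single i 1) 1"]) (auto simp: mpoly_eval_single monom_eval_def polys_in_def)

lemma polynomial_fun_add:
  assumes "polynomial_fun N F" "polynomial_fun N G"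
  shows "polynomial_fun N (\<lambda>x. F x + G x)"
proof -
  obtain P Q where P: "P \<in> polys_in N" "\<And>x. mpoly_eval P x = F x"
    and Q: "Q \<in> polys_in N" "\<And>x. mpoly_eval Q x = G x"
    using assms unfolding polynomial_fun_def by blast
  have "P + Q \<in> polys_in N"
    using P(1) Q(1) Poly_Mapping.keys_add[of P Q] by (auto simp: polys_in_def)
  then show ?thesis
    unfolding polynomial_fun_def by (intro bexI[of _ "P + Q"]) (simp_all add: mpoly_eval_add P Q)
qed

lemma polynomial_fun_mult:
  assumes "polynomial_fun N F" "polynomial_fun N G"
  shows "polynomial_fun N (\<lambda>x. F x * G x)"
proof -
  obtain P Q where P: "P \<in> polys_in N" "\<And>x. mpoly_eval P x = F x"
    and Q: "Q \<in> polys_in N" "\<And>x. mpoly_eval Q x = G x"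
    using assms unfolding polynomial_fun_def by blast
  have "keys u \<subseteq> {..<N}" if u: "u \<in> keys (P * Q)" for u
  proof -
    obtain s t where "u = s + t" "s \<in> keys P" "t \<in> keys Q"
      using keys_mult[of P Q] u by blast
    then show ?thesis
      using P(1) Q(1) Poly_Mapping.keys_add[of s t] unfolding polys_in_def by blast
  qed
  then have "P * Q \<in> polys_in N" by (simp add: polys_in_def)
  then show ?thesis
    unfolding polynomial_fun_def by (intro bexI[of _ "P * Q"]) (simp_all add: mpoly_eval_mult P Q)
qed

lemma polynomial_fun_diff:
  "polynomial_fun N F \<Longrightarrow> polynomial_fun N G \<Longrightarrow> polynomial_fun N (\<lambda>x. F x - G x)"
  using polynomial_fun_add[of N F "\<lambda>x. (- 1) * G x"] polynomial_fun_mult[of N "\<lambda>x. - 1" G]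
  by (simp add: polynomial_fun_const)

lemma polynomial_fun_power2: "polynomial_fun N F \<Longrightarrow> polynomial_fun N (\<lambda>x. (F x)\<^sup>2)"
  by (simp add: power2_eq_square polynomial_fun_mult)

lemmas polynomial_fun_intros = polynomial_fun_const polynomial_fun_var polynomial_fun_add
  polynomial_fun_diff polynomial_fun_mult polynomial_fun_power2

lemma polynomial_fun_list:
  "\<forall>G \<in> set Gs. polynomial_fun N G \<Longrightarrow>
    \<exists>Ps. set Ps \<subseteq> polys_in N \<and> map mpoly_eval Ps = Gs"
proof (induction Gs)
  case (Cons G Gs)
  then obtain P Ps where "P \<in> polys_in N" "\<And>x. mpoly_eval P x = G x"
    "set Ps \<subseteq> polys_in N" "map mpoly_eval Ps = Gs"
    unfolding polynomial_fun_def by auto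
  then show ?case by (intro exI[of _ "P # Ps"]) auto
qed simp

subsection \<open>The loop\<close>

text \<open>
  Coordinate \<open>1\<close> is the constant \<open>1\<close>, coordinate \<open>0\<close> becomes \<open>e\<close> after one step, \<open>2\<close> is a decreasing
  counter, \<open>3\<close> a constant bound, and \<open>4\<close> is a power of two that is halved in every step.  For each
  unknown \<open>j\<close> there are a constant coordinate \<open>5 + 2 * j\<close> with its value \<open>x\<close> and a coordinate
  \<open>6 + 2 * j\<close> that is halved and meant to start as \<open>2 ^ (c - x)\<close>, where \<open>c\<close> is the start of the counter.
  The halving is essential: the integer inputs of infinite runs are closed under an integer matrix,
  so that such a loop could not recognize the start of the run.
\<close>

definition loop_mat :: "nat \<Rightarrow> rat \<Rightarrow> rat mat" where
  "loop_mat N e = mat N N (\<lambda>(i, j).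
    if i = 0 then (if j = 1 then e else 0)
    else if i = 2 \<and> j = 1 then - 1
    else if i \<noteq> j then 0
    else if 4 \<le> i \<and> even i then 1 / 2 else 1)"

lemma loop_mat_carrier: "loop_mat N e \<in> carrier_mat N N"
  by (simp add: loop_mat_def)

lemma loop_mat_mult:
  assumes "X \<in> carrier_vec N" "i < N" "N \<ge> 3"
  shows "(loop_mat N e *\<^sub>v X) $ i =
    (if i = 0 then e * X $ 1 else if i = 2 then X $ 2 - X $ 1
     else if 4 \<le> i \<and> even i then X $ i / 2 else X $ i)"
proof -
  let ?c = "\<lambda>j. if i = 0 then (if j = 1 then e else 0) else if i = 2 \<and> j = 1 then - 1
    else if i \<noteq> j then 0 else if 4 \<le> i \<and> even i then 1 / 2 else 1"
  have "(loop_mat N e *\<^sub>v X) $ i = (\<Sum>j<N. ?c j * X $ j)"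
    using assms by (simp add: loop_mat_def scalar_prod_def lessThan_atLeast0)
  also have "\<dots> = (\<Sum>j<N. (if j = 1 then (if i = 0 then e else if i = 2 then - 1 else 0) * X $ 1 else 0)
      + (if j = i then (if i = 0 then 0 else if 4 \<le> i \<and> even i then 1 / 2 else 1) * X $ i else 0))"
    if "i \<noteq> 1" using that by (intro sum.cong refl) auto
  also have "\<dots> = (if i = 0 then e * X $ 1 else if i = 2 then X $ 2 - X $ 1
     else if 4 \<le> i \<and> even i then X $ i / 2 else X $ i)"
    using assms by (simp add: sum.distrib sum.delta)
  finally have "i \<noteq> 1 \<Longrightarrow> ?thesis" by simp
  moreover have "?thesis" if i: "i = 1"
  proof -
    have "(\<Sum>j<N. ?c j * X $ j) = (\<Sum>j<N. if j = 1 then X $ 1 else 0)"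
      using i by (intro sum.cong refl) auto
    then show ?thesis
      using assms i \<open>(loop_mat N e *\<^sub>v X) $ i = (\<Sum>j<N. ?c j * X $ j)\<close> by (simp add: sum.delta)
  qed
  ultimately show ?thesis by blast
qed

lemma loop_orbit:
  assumes "X \<in> carrier_vec N" "i < N" "N \<ge> 3"
  shows "((loop_mat N e ^\<^sub>m n) *\<^sub>v X) $ i =
    (if i = 0 then (if n = 0 then X $ 0 else e * X $ 1)
     else if i = 2 then X $ 2 - of_nat n * X $ 1
     else if 4 \<le> i \<and> even i then X $ i / 2 ^ n else X $ i)"
  using assms
proof (induction n arbitrary: X)
  case 0
  then show ?case by (simp add: loop_mat_def)
next
  case (Suc n)
  have A: "loop_mat N e \<in> carrier_mat N N" "loop_mat N e ^\<^sub>m n \<in> carrier_mat N N"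
    using loop_mat_carrier by auto
  then have AX: "loop_mat N e *\<^sub>v X \<in> carrier_vec N"
    using Suc.prems by auto
  have "((loop_mat N e ^\<^sub>m Suc n) *\<^sub>v X) $ i = ((loop_mat N e ^\<^sub>m n) *\<^sub>v (loop_mat N e *\<^sub>v X)) $ i"
    by (simp only: pow_mat.simps assoc_mult_mat_vec[OF A(2,1) Suc.prems(1)])
  then show ?case
    using Suc.IH[OF AX Suc.prems(2,3)] Suc.prems
    by (auto simp: loop_mat_mult field_simps)
qed

text \<open>
  These inequalities hold forever along \<open>c - n\<close>, \<open>p / 2 ^ n\<close> only if \<open>c \<ge> 0\<close> and \<open>p = 2 ^ c\<close>: the second
  one excludes \<open>c < 0\<close>, and the last one only matters when the counter is \<open>0\<close>, where it forces
  \<open>p / 2 ^ n\<close> to be closer to \<open>1\<close> than the reciprocal of the bound in coordinate \<open>3\<close>.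
\<close>

definition sync :: "(rat vec \<Rightarrow> rat) \<Rightarrow> (rat vec \<Rightarrow> rat) \<Rightarrow> (rat vec \<Rightarrow> rat) list" where
  "sync c p =
    [p, \<lambda>x. 1 + c x * p x, \<lambda>x. x $ 3 + 1 - 2 * p x,
     \<lambda>x. 1 - (x $ 3)\<^sup>2 * (p x - 1)\<^sup>2 + (c x)\<^sup>2 * (x $ 3)\<^sup>2 * ((p x)\<^sup>2 + 1)]"

definition synced :: "rat \<Rightarrow> rat \<Rightarrow> rat \<Rightarrow> bool" where
  "synced D c p \<longleftrightarrow> 0 < p \<and> 0 < 1 + c * p \<and> 0 < D + 1 - 2 * p \<and>
    0 < 1 - D\<^sup>2 * (p - 1)\<^sup>2 + c\<^sup>2 * D\<^sup>2 * (p\<^sup>2 + 1)"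

lemma sync_iff: "(\<forall>G \<in> set (sync c p). 0 < G x) \<longleftrightarrow> synced (x $ 3) (c x) (p x)"
  by (simp add: sync_def synced_def)

lemma synced_sound:
  fixes c p D :: int
  assumes "\<And>n :: nat. synced (of_int D) (of_int c - of_nat n) (of_int p / 2 ^ n)"
  shows "c \<ge> 0 \<and> p = 2 ^ nat c"
proof -
  have "rat_of_int 0 < rat_of_int p" "rat_of_int 0 < rat_of_int (1 + c * p)"
    "rat_of_int 0 < rat_of_int (D + 1 - 2 * p)"
    using assms[of 0] by (simp_all add: synced_def)
  then have "0 < p" "0 < 1 + c * p" "0 < D + 1 - 2 * p"
    unfolding of_int_less_iff .
  then have p: "p > 0" and cp: "1 + c * p > 0" and D: "D \<ge> 2 * p" by simp_all
  have c: "c \<ge> 0"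
  proof (rule ccontr)
    assume "\<not> c \<ge> 0"
    then have "c * p \<le> (- 1) * p" using p by (intro mult_right_mono) auto
    then show False using p cp by simp
  qed
  define h :: int where "h = 2 ^ nat c"
  have h: "h > 0" by (simp add: h_def)
  have "rat_of_int c - of_nat (nat c) = 0" using c by simp
  moreover have "(2::rat) ^ nat c = of_int h" by (simp add: h_def)
  ultimately have "synced (of_int D) 0 (of_int p / of_int h)"
    using assms[of "nat c"] by (simp only:)
  then have "0 < 1 - (rat_of_int D)\<^sup>2 * (of_int p / of_int h - 1)\<^sup>2"
    unfolding synced_def by simp
  then have "(rat_of_int D * (of_int p / of_int h - 1))\<^sup>2 < 1"
    unfolding power_mult_distrib by linarith
  then have "\<bar>rat_of_int D * (of_int p / of_int h - 1)\<bar> < 1"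
    by (simp add: abs_square_less_1)
  moreover have "rat_of_int D * (of_int p / of_int h - 1) = of_int (D * (p - h)) / of_int h"
    using h by (simp add: field_simps)
  ultimately have "\<bar>rat_of_int (D * (p - h))\<bar> < of_int h"
    using h by (simp add: abs_divide divide_less_eq)
  then have less: "\<bar>D * (p - h)\<bar> < h"
    by (simp only: of_int_abs[symmetric] of_int_less_iff)
  \<comment> \<open>Otherwise \<open>D * \<bar>p - h\<bar> < h\<close> gives \<open>D < h\<close>,
    hence \<open>2 * p < h\<close>. Then \<open>h - p\<close> exceeds half of \<open>h\<close>, and
    \<open>D \<ge> 2\<close> makes \<open>D * (h - p)\<close> larger than \<open>h\<close>.\<close>
  have "p = h"
  proof (rule ccontr)
    assume "p \<noteq> h"
    then have "1 \<le> \<bar>p - h\<bar>" by simp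
    then have "D * 1 \<le> D * \<bar>p - h\<bar>" using D p by (intro mult_left_mono) auto
    moreover have "\<bar>D * (p - h)\<bar> = D * \<bar>p - h\<bar>" using D p by (simp add: abs_mult)
    ultimately have "D < h" using less by linarith
    then have "2 * p < h" using D by simp
    moreover have "2 * (h - p) \<le> D * (h - p)"
      using D p \<open>2 * p < h\<close> by (intro mult_right_mono) auto
    moreover have "D * (h - p) < h"
      using less by (simp add: abs_mult abs_if algebra_simps split: if_splits)
    ultimately show False by simp
  qed
  then show ?thesis using c by (simp add: h_def)
qed

lemma synced_complete:
  fixes D :: rat
  assumes "D \<ge> 2 * 2 ^ a"
  shows "synced D (of_nat a - of_nat n) (2 ^ a / 2 ^ n)"
proof -
  let ?p = "2 ^ a / 2 ^ n :: rat" and ?c = "rat_of_nat a - of_nat n"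
  have p: "0 < ?p" by simp
  have "?p \<le> 2 ^ a" by (simp add: divide_le_eq)
  then have 1: "0 < D + 1 - 2 * ?p" using assms by linarith
  have 2: "0 < 1 + ?c * ?p"
  proof (cases "n \<le> a")
    case True
    then have "0 \<le> ?c * ?p" by (intro mult_nonneg_nonneg) auto
    then show ?thesis by linarith
  next
    case False
    \<comment> \<open>After the counter has passed zero, the product is \<open>- m / 2 ^ m\<close>,
      which stays above \<open>-1\<close>.\<close>
    define m where "m = n - a"
    then have n: "n = a + m" using False by simp
    have "rat_of_nat m < of_nat (2 ^ m)" by (simp only: of_nat_less_iff less_exp)
    then show ?thesis by (simp add: n power_add field_simps)
  qed
  have 3: "0 < 1 - D\<^sup>2 * (?p - 1)\<^sup>2 + ?c\<^sup>2 * D\<^sup>2 * (?p\<^sup>2 + 1)"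
  proof (cases "a = n")
    case False
    \<comment> \<open>Away from zero the squared counter is at least \<open>1\<close>, and the last
      summand outweighs the negative one because \<open>(p - 1)^2 \<le> p^2 + 1\<close> for positive
      \<open>p\<close>.\<close>
    then have "0 < (int a - int n)\<^sup>2" by simp
    then have "1 \<le> (int a - int n)\<^sup>2" by linarith
    then have "rat_of_int 1 \<le> rat_of_int ((int a - int n)\<^sup>2)" by (simp only: of_int_le_iff)
    then have "1 \<le> ?c\<^sup>2" by simp
    then have "1 * (D\<^sup>2 * (?p\<^sup>2 + 1)) \<le> ?c\<^sup>2 * (D\<^sup>2 * (?p\<^sup>2 + 1))"
      by (intro mult_right_mono) auto
    moreover have "D\<^sup>2 * (?p - 1)\<^sup>2 \<le> D\<^sup>2 * (?p\<^sup>2 + 1)"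
      using p by (intro mult_left_mono) (simp_all add: power2_diff)
    ultimately show ?thesis by (simp add: mult.assoc)
  qed simp
  show ?thesis unfolding synced_def using p 1 2 3 by blast
qed

section \<open>Guards and the integer inputs of infinite runs\<close>

definition xvar :: "nat \<Rightarrow> nat" where "xvar j = 5 + 2 * j"
definition qvar :: "nat \<Rightarrow> nat" where "qvar j = 6 + 2 * j"

text \<open>In \<open>Is_exp\<close>, \<open>u = 2 ^ v\<close> is multiplied by
  \<open>2 ^ (c - v)\<close> to become \<open>u * 2 ^ (c - v) = 2 ^ c\<close>. Each side contains
  one halved coordinate, so the equation survives every step.\<close>

primrec atom_fun :: "nat atom \<Rightarrow> rat vec \<Rightarrow> rat" where
  "atom_fun (Is_const u c) = (\<lambda>x. x $ xvar u - of_nat c)"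
| "atom_fun (Is_sum u v w) = (\<lambda>x. x $ xvar u - (x $ xvar v + x $ xvar w))"
| "atom_fun (Is_prod u v w) = (\<lambda>x. x $ xvar u - x $ xvar v * x $ xvar w)"
| "atom_fun (Is_exp u v) = (\<lambda>x. x $ xvar u * x $ qvar v - x $ 4)"

text \<open>For an integer \<open>t\<close> the inequality \<open>1 - t^2 > 0\<close> says
  \<open>t = 0\<close>. The synchronisation of \<open>c - x\<close> also yields
  \<open>x \<le> c\<close>, so that \<open>2 ^ (c - x)\<close> is an integer.\<close>

definition guards :: "nat \<Rightarrow> nat atom list \<Rightarrow> (rat vec \<Rightarrow> rat) list" where
  "guards K C =
    [\<lambda>x. 1 - (x $ 1 - 1)\<^sup>2, \<lambda>x. 1 - (x $ xvar 0 - x $ 0)\<^sup>2]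
    @ sync (\<lambda>x. x $ 2) (\<lambda>x. x $ 4)
    @ concat (map (\<lambda>j. (\<lambda>x. x $ xvar j + 1) # sync (\<lambda>x. x $ 2 - x $ xvar j) (\<lambda>x. x $ qvar j)) [0..<K])
    @ map (\<lambda>a x. 1 - (atom_fun a x)\<^sup>2) C"

lemma guards_iff:
  "(\<forall>G \<in> set (guards K C). 0 < G x) \<longleftrightarrow>
    0 < 1 - (x $ 1 - 1)\<^sup>2 \<and> 0 < 1 - (x $ xvar 0 - x $ 0)\<^sup>2 \<and>
    synced (x $ 3) (x $ 2) (x $ 4) \<and>
    (\<forall>j < K. 0 < x $ xvar j + 1 \<and> synced (x $ 3) (x $ 2 - x $ xvar j) (x $ qvar j)) \<and>
    (\<forall>a \<in> set C. 0 < 1 - (atom_fun a x)\<^sup>2)"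
  unfolding guards_def by (auto simp: ball_Un sync_iff)

lemma polynomial_fun_sync:
  "polynomial_fun N c \<Longrightarrow> polynomial_fun N p \<Longrightarrow> 3 < N \<Longrightarrow> \<forall>G \<in> set (sync c p). polynomial_fun N G"
  by (auto simp: sync_def intro!: polynomial_fun_intros)

lemma polynomial_fun_guards:
  assumes "\<forall>a \<in> set C. set_atom a \<subseteq> {..<K}" "0 < K" "G \<in> set (guards K C)"
  shows "polynomial_fun (5 + 2 * K) G"
proof -
  have atom: "polynomial_fun (5 + 2 * K) (atom_fun a)" if "set_atom a \<subseteq> {..<K}" for a
    using that by (cases a) (auto simp: xvar_def qvar_def intro!: polynomial_fun_intros)
  have "\<forall>G \<in> set (sync (\<lambda>x. x $ 2 - x $ xvar j) (\<lambda>x. x $ qvar j)). polynomial_fun (5 + 2 * K) G"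
    if "j < K" for j
    using that by (intro polynomial_fun_sync polynomial_fun_intros) (auto simp: xvar_def qvar_def)
  moreover have "\<forall>G \<in> set (sync (\<lambda>x. x $ 2) (\<lambda>x. x $ 4)). polynomial_fun (5 + 2 * K) G"
    by (intro polynomial_fun_sync polynomial_fun_intros) auto
  moreover have "polynomial_fun (5 + 2 * K) (\<lambda>x. x $ xvar j + 1)" if "j < K" for j
    using that by (intro polynomial_fun_intros) (auto simp: xvar_def)
  moreover have "polynomial_fun (5 + 2 * K) (\<lambda>x. 1 - (x $ xvar 0 - x $ 0)\<^sup>2)"
    using assms(2) by (intro polynomial_fun_intros) (auto simp: xvar_def)
  moreover have "polynomial_fun (5 + 2 * K) (\<lambda>x. 1 - (x $ 1 - 1)\<^sup>2)"
    by (intro polynomial_fun_intros) auto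
  moreover have "polynomial_fun (5 + 2 * K) (\<lambda>x. 1 - (atom_fun a x)\<^sup>2)" if "a \<in> set C" for a
    using atom[of a] assms(1) that by (intro polynomial_fun_intros) auto
  ultimately show ?thesis using assms(3) by (auto simp: guards_def)
qed

lemma rat_square_less_1: "0 < 1 - (rat_of_int i)\<^sup>2 \<longleftrightarrow> i = 0"
proof -
  have "0 < 1 - (rat_of_int i)\<^sup>2 \<longleftrightarrow> \<bar>rat_of_int i\<bar> < 1"
    by (simp add: abs_square_less_1)
  also have "\<dots> \<longleftrightarrow> \<bar>i\<bar> < 1"
    by (metis of_int_1 of_int_abs of_int_less_iff)
  finally show ?thesis by auto
qed

lemma guards_sound:
  fixes X :: "int vec"
  assumes C: "\<forall>a \<in> set C. set_atom a \<subseteq> {..<K}" and K: "0 < K" and X: "X \<in> carrier_vec (5 + 2 * K)"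
    and pos: "\<And>n G. G \<in> set (guards K C) \<Longrightarrow>
      0 < G ((loop_mat (5 + 2 * K) (of_nat e) ^\<^sub>m n) *\<^sub>v map_vec rat_of_int X)"
  shows "\<exists>\<sigma>. \<sigma> 0 = e \<and> (\<forall>a \<in> set C. holds \<sigma> a)"
proof -
  let ?N = "5 + 2 * K"
  define y where "y n = (loop_mat ?N (of_nat e) ^\<^sub>m n) *\<^sub>v map_vec rat_of_int X" for n
  have idx: "xvar j < ?N" "qvar j < ?N" if "j < K" for j
    using that by (auto simp: xvar_def qvar_def)
  have q_props: "qvar j \<noteq> 0" "qvar j \<noteq> 2" "4 \<le> qvar j" "even (qvar j)" for j
    by (simp_all add: qvar_def)
  have x_props: "xvar j \<noteq> 0" "xvar j \<noteq> 2" "odd (xvar j)" for j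
    by (simp_all add: xvar_def)
  have Y: "y n $ i = (if i = 0 then (if n = 0 then of_int (X $ 0) else of_nat e * of_int (X $ 1))
     else if i = 2 then of_int (X $ 2) - of_nat n * of_int (X $ 1)
     else if 4 \<le> i \<and> even i then of_int (X $ i) / 2 ^ n else of_int (X $ i))" if "i < ?N" for i n
    unfolding y_def using that X by (subst loop_orbit) auto
  have "\<forall>G \<in> set (guards K C). 0 < G (y n)" for n
    unfolding y_def using pos by blast
  note g = this[unfolded guards_iff]
  have g_x: "0 < y n $ xvar j + 1"
    and g_q: "synced (y n $ 3) (y n $ 2 - y n $ xvar j) (y n $ qvar j)" if "j < K" for n j
    using g[of n] that by blast+
  have one: "X $ 1 = 1"
    using g[of 0] rat_square_less_1[of "X $ 1 - 1"] Y[of 1 0] by simp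
  \<comment> \<open>Read after one step, when the matrix has overwritten coordinate \<open>0\<close>
    by \<open>e\<close>; the input there is arbitrary.\<close>
  have e: "X $ xvar 0 = int e"
    using g[of 1] rat_square_less_1[of "X $ xvar 0 - int e"] Y[of 0 1] Y[of "xvar 0" 1] idx[of 0] K
        x_props[of 0]
    by (simp add: one[unfolded One_nat_def])
  have c: "X $ 2 \<ge> 0 \<and> X $ 4 = 2 ^ nat (X $ 2)"
  proof (rule synced_sound[of "X $ 3"])
    show "synced (of_int (X $ 3)) (of_int (X $ 2) - of_nat n) (of_int (X $ 4) / 2 ^ n)" for n
      using g[of n] Y[of 2 n] Y[of 3 n] Y[of 4 n] by (simp add: one[unfolded One_nat_def])
  qed
  have x: "X $ xvar j \<ge> 0" if "j < K" for j
  proof -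
    have "0 < rat_of_int (X $ xvar j) + 1"
      using g_x[OF that, of 0] Y[of "xvar j" 0] idx[OF that] x_props[of j] by simp
    then have "rat_of_int 0 < rat_of_int (X $ xvar j + 1)" by simp
    then show ?thesis unfolding of_int_less_iff by simp
  qed
  have q: "X $ 2 - X $ xvar j \<ge> 0 \<and> X $ qvar j = 2 ^ nat (X $ 2 - X $ xvar j)" if "j < K" for j
  proof (rule synced_sound[of "X $ 3"])
    have eq: "rat_of_int (X $ 2 - X $ xvar j) - of_nat n = of_int (X $ 2) - of_nat n - of_int (X $
        xvar j)" for n
      by simp
    show "synced (of_int (X $ 3)) (of_int (X $ 2 - X $ xvar j) - of_nat n) (of_int (X $ qvar j) / 2
        ^ n)" for n
      unfolding eq using g_q[OF that, of n] Y[of 2 n] Y[of 3 n] Y[of "xvar j" n] Y[of "qvar j" n]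
          idx[OF that]
        x_props[of j] q_props[of j]
      by (simp add: one[unfolded One_nat_def])
  qed
  define \<sigma> where "\<sigma> j = nat (X $ xvar j)" for j
  have \<sigma>: "X $ xvar j = int (\<sigma> j)" if "j < K" for j
    using x[OF that] by (simp add: \<sigma>_def)
  have Y0: "y 0 $ i = of_int (X $ i)" if "i < ?N" for i
    using Y[OF that, of 0] by simp
  have "holds \<sigma> a" if a: "a \<in> set C" for a
  proof -
    \<comment> \<open>Read at the start, where the coordinates to be halved are still
      integers.\<close>
    have pos: "0 < 1 - (atom_fun a (y 0))\<^sup>2"
      using g[of 0] a by blast
    have vars: "set_atom a \<subseteq> {..<K}" using C a by blast
    show ?thesis
    proof (cases a)
      case (Is_const u c)
      then have "X $ xvar u - int c = 0"
        using pos vars Y0[OF idx(1)] rat_square_less_1[of "X $ xvar u - int c"] by simp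
      then show ?thesis using Is_const vars \<sigma> by simp
    next
      case (Is_sum u v w)
      then have "X $ xvar u - (X $ xvar v + X $ xvar w) = 0"
        using pos vars Y0[OF idx(1)] rat_square_less_1[of "X $ xvar u - (X $ xvar v + X $ xvar w)"]
            by simp
      then have "int (\<sigma> u) = int (\<sigma> v + \<sigma> w)" using Is_sum vars \<sigma> by simp
      then show ?thesis unfolding Is_sum holds.simps of_nat_eq_iff .
    next
      case (Is_prod u v w)
      then have "X $ xvar u - X $ xvar v * X $ xvar w = 0"
        using pos vars Y0[OF idx(1)] rat_square_less_1[of "X $ xvar u - X $ xvar v * X $ xvar w"] by simp
      then have "int (\<sigma> u) = int (\<sigma> v * \<sigma> w)" using Is_prod vars \<sigma> by simp
      then show ?thesis unfolding Is_prod holds.simps of_nat_eq_iff .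
    next
      case (Is_exp u v)
      then have uv: "u < K" "v < K" using vars by auto
      have "X $ xvar u * X $ qvar v - X $ 4 = 0"
        using Is_exp pos uv Y0[OF idx(1)] Y0[OF idx(2)] Y0[of 4]
          rat_square_less_1[of "X $ xvar u * X $ qvar v - X $ 4"] by simp
      then have "int (\<sigma> u) * 2 ^ nat (X $ 2 - int (\<sigma> v)) = 2 ^ nat (X $ 2)"
        using q[OF uv(2)] c \<sigma>[OF uv(1)] \<sigma>[OF uv(2)] by simp
      also have "nat (X $ 2) = \<sigma> v + nat (X $ 2 - int (\<sigma> v))"
        using q[OF uv(2)] \<sigma>[OF uv(2)] by linarith
      finally have "int (\<sigma> u) = 2 ^ \<sigma> v"
        by (simp add: power_add)
      then have "int (\<sigma> u) = int (2 ^ \<sigma> v)" by simp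
      then show ?thesis unfolding Is_exp holds.simps of_nat_eq_iff .
    qed
  qed
  moreover have "\<sigma> 0 = e" using e by (simp add: \<sigma>_def)
  ultimately show ?thesis by blast
qed

lemma guards_complete:
  assumes C: "\<forall>a \<in> set C. set_atom a \<subseteq> {..<K}" and K: "0 < K"
    and \<sigma>: "\<sigma> 0 = e" "\<forall>a \<in> set C. holds \<sigma> a"
  shows "\<exists>X :: int vec. X \<in> carrier_vec (5 + 2 * K) \<and> (\<forall>n. \<forall>G \<in> set (guards K C).
      0 < G ((loop_mat (5 + 2 * K) (of_nat e) ^\<^sub>m n) *\<^sub>v map_vec rat_of_int X))"
proof -
  let ?N = "5 + 2 * K"
  define s where "s = (\<Sum>j<K. \<sigma> j)"
  have s: "\<sigma> j \<le> s" if "j < K" for j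
    unfolding s_def using that by (intro member_le_sum) auto
  \<comment> \<open>The counter starts at a common bound \<open>s\<close> of the unknowns, and
    \<open>2 * 2 ^ s\<close> meets the demand of \<open>synced_complete\<close> for \<open>s\<close>
    and for all \<open>s - \<sigma> j\<close>.\<close>
  define X :: "int vec" where "X = vec ?N (\<lambda>i. if i = 0 then int e else if i = 1 then 1
    else if i = 2 then int s else if i = 3 then 2 * 2 ^ s else if i = 4 then 2 ^ s
    else if odd i then int (\<sigma> ((i - 5) div 2)) else 2 ^ (s - \<sigma> ((i - 6) div 2)))"
  have X: "X \<in> carrier_vec ?N" by (simp add: X_def)
  define y where "y n = (loop_mat ?N (of_nat e) ^\<^sub>m n) *\<^sub>v map_vec rat_of_int X" for n
  have Y: "y n $ i = (if i = 0 then (if n = 0 then of_int (X $ 0) else of_nat e * of_int (X $ 1))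
     else if i = 2 then of_int (X $ 2) - of_nat n * of_int (X $ 1)
     else if 4 \<le> i \<and> even i then of_int (X $ i) / 2 ^ n else of_int (X $ i))" if "i < ?N" for i n
    unfolding y_def using that X by (subst loop_orbit) auto
  have Ys: "y n $ 0 = of_nat e" "y n $ 1 = 1" "y n $ 2 = of_nat s - of_nat n"
    "y n $ 3 = 2 * 2 ^ s" "y n $ 4 = 2 ^ s / 2 ^ n" for n
    using Y[of 0 n] Y[of 1 n] Y[of 2 n] Y[of 3 n] Y[of 4 n] K by (simp_all add: X_def)
  have Yx: "y n $ xvar j = of_nat (\<sigma> j)" if "j < K" for n j
  proof -
    have "xvar j < ?N" "odd (xvar j)" "xvar j \<ge> 5" "(xvar j - 5) div 2 = j"
      using that by (auto simp: xvar_def)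
    then show ?thesis using Y[of "xvar j" n] by (simp add: X_def)
  qed
  have Yq: "y n $ qvar j = 2 ^ (s - \<sigma> j) / 2 ^ n" if "j < K" for n j
  proof -
    have "qvar j < ?N" "even (qvar j)" "qvar j \<ge> 6" "(qvar j - 6) div 2 = j"
      using that by (auto simp: qvar_def)
    then show ?thesis using Y[of "qvar j" n] by (simp add: X_def)
  qed
  have "\<forall>G \<in> set (guards K C). 0 < G (y n)" for n
    unfolding guards_iff
  proof (intro conjI allI impI ballI)
    show "0 < 1 - (y n $ 1 - 1)\<^sup>2" by (simp add: Ys[unfolded One_nat_def])
    show "0 < 1 - (y n $ xvar 0 - y n $ 0)\<^sup>2"
      by (simp add: Ys Yx[OF K] \<sigma>)
    show "synced (y n $ 3) (y n $ 2) (y n $ 4)"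
      unfolding Ys by (rule synced_complete) simp
    show "0 < y n $ xvar j + 1" if "j < K" for j
      using that by (simp add: Yx add_nonneg_pos)
    show "synced (y n $ 3) (y n $ 2 - y n $ xvar j) (y n $ qvar j)" if j: "j < K" for j
    proof -
      have "(2::rat) ^ (s - \<sigma> j) \<le> 2 ^ s" by (rule power_increasing) auto
      then have "synced (2 * 2 ^ s) (of_nat (s - \<sigma> j) - of_nat n) (2 ^ (s - \<sigma> j) / 2 ^ n)"
        by (intro synced_complete) simp
      moreover have "rat_of_nat s - of_nat n - of_nat (\<sigma> j) = of_nat (s - \<sigma> j) - of_nat n"
        using s[OF j] by (simp add: of_nat_diff)
      ultimately show ?thesis using j by (simp only: Ys Yx Yq)
    qed
    fix a assume a: "a \<in> set C"
    then have vars: "set_atom a \<subseteq> {..<K}" and holds: "holds \<sigma> a" using C \<sigma> by auto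
    have "atom_fun a (y n) = 0"
    proof (cases a)
      case (Is_exp u v)
      then have "(2::rat) ^ s = 2 ^ \<sigma> v * 2 ^ (s - \<sigma> v)"
        using s[of v] vars by (simp flip: power_add)
      then show ?thesis using Is_exp vars holds by (simp add: Yx Yq Ys)
    qed (use vars holds in \<open>simp_all add: Yx\<close>)
    then show "0 < 1 - (atom_fun a (y n))\<^sup>2" by simp
  qed
  then show ?thesis using X unfolding y_def by blast
qed

subsection \<open>Self-reference\<close>

lemma exp_dioph_fun_prod_encode:
  "exp_dioph_fun s \<Longrightarrow> exp_dioph_fun t \<Longrightarrow> exp_dioph_fun (\<lambda>\<rho>. prod_encode (s \<rho>, t \<rho>))"
  using exp_dioph_fun_div[of "\<lambda>\<rho>. (s \<rho> + t \<rho>) * Suc (s \<rho> + t \<rho>)" "\<lambda>\<rho>. 1"]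
  by (simp add: prod_encode_def triangle_def numeral_2_eq_2 exp_dioph_fun_add exp_dioph_fun_mult
      exp_dioph_fun_Suc exp_dioph_fun_const
      del: mult_Suc_right)

text \<open>\<open>H\<close> sees only variable \<open>0\<close>, so the other free variables can be
  quantified as well. \<open>sum_encode\<close> merges both kinds of variables and keeps
  \<open>Inl 0\<close> at \<open>0\<close>.\<close>

lemma exp_dioph_atoms:
  assumes "exp_dioph (\<lambda>\<rho>. H (\<rho> 0))"
  obtains C :: "nat atom list" where "\<And>e. H e \<longleftrightarrow> (\<exists>\<sigma>. \<sigma> 0 = e \<and> (\<forall>a \<in> set C. holds \<sigma> a))"
proof -
  obtain C :: "(nat + nat) atom list"
    where C: "\<And>\<rho>. H (\<rho> 0) \<longleftrightarrow> (\<exists>\<tau>. \<forall>a \<in> set C. holds (case_sum \<rho> \<tau>) a)"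
    by (rule exp_diophE[OF assms]) blast
  have "H e \<longleftrightarrow> (\<exists>\<sigma>. \<sigma> 0 = e \<and> (\<forall>a \<in> set (map (map_atom sum_encode) C). holds \<sigma> a))" for e
  proof
    assume "H e"
    then obtain \<tau> where \<tau>: "\<forall>a \<in> set C. holds (case_sum (\<lambda>_. e) \<tau>) a"
      using C[of "\<lambda>_. e"] by auto
    have "(case_sum (\<lambda>_. e) \<tau> \<circ> sum_decode) \<circ> sum_encode = case_sum (\<lambda>_. e) \<tau>"
      by (simp add: fun_eq_iff)
    moreover have "(case_sum (\<lambda>_. e) \<tau> \<circ> sum_decode) 0 = e"
      by (simp add: sum_decode_def)
    ultimately show "\<exists>\<sigma>. \<sigma> 0 = e \<and> (\<forall>a \<in> set (map (map_atom sum_encode) C). holds \<sigma> a)"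
      using \<tau> by (intro exI[of _ "case_sum (\<lambda>_. e) \<tau> \<circ> sum_decode"]) (simp add: holds_map_atom)
  next
    assume "\<exists>\<sigma>. \<sigma> 0 = e \<and> (\<forall>a \<in> set (map (map_atom sum_encode) C). holds \<sigma> a)"
    then obtain \<sigma> where \<sigma>: "\<sigma> 0 = e" "\<forall>a \<in> set C. holds (\<sigma> \<circ> sum_encode) a"
      by (auto simp: holds_map_atom)
    have "case_sum (\<lambda>i. \<sigma> (sum_encode (Inl i))) (\<lambda>i. \<sigma> (sum_encode (Inr i))) = \<sigma> \<circ> sum_encode"
      by (rule ext, rename_tac x, case_tac x) simp_all
    then have "H (\<sigma> (sum_encode (Inl 0)))"
      using C[of "\<lambda>i. \<sigma> (sum_encode (Inl i))"] \<sigma>(2) by metis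
    then show "H e" using \<sigma>(1) by (simp add: sum_encode_def)
  qed
  then show thesis by (rule that)
qed

text \<open>The list code unfolded up to the one entry that depends on \<open>e\<close>:
  \<open>z\<close> codes the rest of the first row and \<open>r\<close> the other rows;
  \<open>(2 * e, 1)\<close> is numerator and denominator of \<open>e\<close>, since
  \<open>int_encode\<close> doubles nonnegative integers.\<close>

definition loop_mat_code :: "nat \<Rightarrow> nat \<Rightarrow> nat \<Rightarrow> nat" where
  "loop_mat_code z r e = Suc (prod_encode
    (Suc (prod_encode (rat_code 0, Suc (prod_encode (prod_encode (2 * e, 1), z)))), r))"

lemma exp_dioph_fun_loop_mat_code: "exp_dioph_fun z \<Longrightarrow> exp_dioph_fun r \<Longrightarrow> exp_dioph_fun e \<Longrightarrow>
    exp_dioph_fun (\<lambda>\<rho>. loop_mat_code (z \<rho>) (r \<rho>) (e \<rho>))"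
  unfolding loop_mat_code_def by (intro exp_dioph_intros exp_dioph_fun_prod_encode)

lemma mat_code_loop_mat:
  assumes "N \<ge> 2"
  shows "\<exists>z r. \<forall>e. mat_code (loop_mat N (of_nat e)) = loop_mat_code z r e"
proof (intro exI allI)
  fix e :: nat
  let ?A = "loop_mat N (of_nat e)"
  let ?z = "list_encode (map (\<lambda>_. rat_code 0) [2..<N])"
  let ?r = "list_encode (map (\<lambda>i. list_encode (map (\<lambda>j. rat_code (loop_mat N 0 $$ (i, j))) [0..<N]))
      [1..<N])"
  have rat: "rat_code (of_nat e) = prod_encode (2 * e, 1)"
    by (simp add: rat_code_def int_encode_def sum_encode_def)
  have upt: "[0..<N] = 0 # 1 # [2..<N]" "[0..<N] = 0 # [1..<N]"
    using assms by (simp_all add: upt_conv_Cons numeral_2_eq_2)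
  have head: "map (\<lambda>j. rat_code (?A $$ (0, j))) [0..<N] =
      rat_code 0 # rat_code (of_nat e) # map (\<lambda>_. rat_code 0) [2..<N]"
    unfolding upt(1) using assms by (simp add: loop_mat_def)
  have tail: "map (\<lambda>i. list_encode (map (\<lambda>j. rat_code (?A $$ (i, j))) [0..<N])) [1..<N] =
      map (\<lambda>i. list_encode (map (\<lambda>j. rat_code (loop_mat N 0 $$ (i, j))) [0..<N])) [1..<N]"
    by (intro map_cong arg_cong[where f = list_encode] refl) (simp add: loop_mat_def)
  have "mat_code ?A = list_encode
      (map (\<lambda>i. list_encode (map (\<lambda>j. rat_code (?A $$ (i, j))) [0..<N])) (0 # [1..<N]))"
    unfolding upt(2)[symmetric] by (simp add: mat_code_def mat_to_list_def loop_mat_def comp_def)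
  then show "mat_code ?A = loop_mat_code ?z ?r e"
    by (simp only: list.map head tail rat list_encode.simps loop_mat_code_def)
qed

lemma exp_dioph_loop:
  assumes "exp_dioph (\<lambda>\<rho>. H (\<rho> 0))"
  shows "\<exists>N Ps. N \<ge> 5 \<and> Ps \<noteq> [] \<and> set Ps \<subseteq> polys_in N \<and>
    (\<forall>e. \<not> terminating_over_Z N (loop_mat N (of_nat e)) Ps \<longleftrightarrow> H e)"
proof -
  obtain C :: "nat atom list" where C: "\<And>e. H e \<longleftrightarrow> (\<exists>\<sigma>. \<sigma> 0 = e \<and> (\<forall>a \<in> set C. holds \<sigma> a))"
    using exp_dioph_atoms[OF assms] by blast
  have "finite (set_atom a)" for a :: "nat atom" by (cases a) auto
  then have "finite (\<Union>a \<in> set C. set_atom a)" by simp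
  then obtain K where "\<forall>i \<in> (\<Union>a \<in> set C. set_atom a). i < K"
    using finite_nat_less by blast
  then have K: "\<forall>a \<in> set C. set_atom a \<subseteq> {..<Suc K}" by fastforce
  \<comment> \<open>The successor ensures that the unknown \<open>0\<close>, which carries the
    parameter, has its coordinates.\<close>
  let ?N = "5 + 2 * Suc K"
  obtain Ps where Ps: "set Ps \<subseteq> polys_in ?N" "map mpoly_eval Ps = guards (Suc K) C"
    using polynomial_fun_list[of "guards (Suc K) C" ?N] polynomial_fun_guards[OF K] by blast
  have "\<not> terminates_on A Ps x \<longleftrightarrow> (\<forall>n. \<forall>G \<in> set (guards (Suc K) C). 0 < G ((A ^\<^sub>m n) *\<^sub>v x))" for A x
    unfolding terminates_on_def Ps(2)[symmetric] by (force simp: in_set_conv_nth not_le)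
  then have "\<not> terminating_over_Z ?N (loop_mat ?N (of_nat e)) Ps \<longleftrightarrow> H e" for e
    unfolding terminating_over_Z_def C
    using guards_sound[OF K, of _ e] guards_complete[OF K, of _ e] by blast
  moreover have "Ps \<noteq> []" using Ps(2) by (auto simp: guards_def)
  ultimately show ?thesis using Ps(1) by (intro exI[of _ ?N] exI[of _ Ps]) auto
qed

theorem theorem1:
  shows "\<not> (\<exists>f :: recf. \<forall>(N :: nat) (m :: nat) (A :: rat mat) (Ps :: rat_mpoly list).
    N \<ge> 1 \<and> m \<ge> 1 \<and> A \<in> carrier_mat N N \<and> length Ps = m \<and> set Ps \<subseteq> polys_in N \<longrightarrow>
    computes f [N, m, mat_code A, polys_code N Ps] (if terminating_over_Z N A Ps then 1 else 0))"
proof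
  assume "\<exists>f :: recf. \<forall>(N :: nat) (m :: nat) (A :: rat mat) (Ps :: rat_mpoly list).
    N \<ge> 1 \<and> m \<ge> 1 \<and> A \<in> carrier_mat N N \<and> length Ps = m \<and> set Ps \<subseteq> polys_in N \<longrightarrow>
    computes f [N, m, mat_code A, polys_code N Ps] (if terminating_over_Z N A Ps then 1 else 0)"
  then obtain f where f: "\<And>N A Ps. N \<ge> 1 \<Longrightarrow> Ps \<noteq> [] \<Longrightarrow> A \<in> carrier_mat N N \<Longrightarrow> set Ps \<subseteq> polys_in N \<Longrightarrow>
    computes f [N, length Ps, mat_code A, polys_code N Ps] (if terminating_over_Z N A Ps then 1 else 0)"
    by (metis One_nat_def Suc_leI length_greater_0_conv)
  define H where "H e \<longleftrightarrow> (\<exists>N m z r p. e = prod_encode (N, prod_encode (m, prod_encode (z, prod_encode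
      (r, p))))
    \<and> computes f [N, m, loop_mat_code z r e, p] 1)" for e
  have "exp_dioph (\<lambda>\<rho>. H (\<rho> 0))"
    unfolding H_def
    by (intro exp_dioph_ex exp_dioph_conj exp_dioph_eq exp_dioph_fun_var exp_dioph_fun_prod_encode
        exp_dioph_computes[where k = "Suc (Suc (Suc (Suc 0)))"] exp_dioph_list_Cons
            exp_dioph_list_Nil exp_dioph_fun_loop_mat_code exp_dioph_fun_const)
  then obtain N Ps where N: "N \<ge> 5" and Ps: "Ps \<noteq> []" "set Ps \<subseteq> polys_in N"
    and loop: "\<And>e. \<not> terminating_over_Z N (loop_mat N (of_nat e)) Ps \<longleftrightarrow> H e"
    using exp_dioph_loop by blast
  obtain z r where code: "\<And>e. mat_code (loop_mat N (of_nat e)) = loop_mat_code z r e"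
    using mat_code_loop_mat[of N] N by auto
  \<comment> \<open>Not circular: \<open>N\<close>, \<open>Ps\<close>, \<open>z\<close> and
    \<open>r\<close> were all fixed independently of \<open>e\<close>.\<close>
  define e where "e = prod_encode (N, prod_encode (length Ps, prod_encode (z, prod_encode (r,
      polys_code N Ps))))"
  have H: "H e \<longleftrightarrow> computes f [N, length Ps, loop_mat_code z r e, polys_code N Ps] 1"
    unfolding H_def by (auto simp: e_def)
  \<comment> \<open>The loop at \<open>e\<close> runs forever on some input exactly if
    \<open>H e\<close>, that is, exactly if \<open>f\<close> answers \<open>1\<close>; but a correct
    \<open>f\<close> answers \<open>0\<close> in this case.\<close>
  have "computes f [N, length Ps, loop_mat_code z r e, polys_code N Ps] (if H e then 0 else 1)"
    using f[of N Ps "loop_mat N (of_nat e)"] N Ps loop_mat_carrier loop[of e] by (auto simp: code)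
  then show False
    using H computes_deterministic by (metis zero_neq_one)
qed

end
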